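(* Let $\lambda\in(0,\tfrac12)$, $\epsilon>0$, $\epsilon_1>0$, $\epsilon_2\ge0$, $\rho>0$, and let $m,n$ be positive integers with $N=mn$. Suppose that in every replication the algorithm's output satisfies the Outer Approximation Condition and the Termination Condition with tolerance $\epsilon_1$ (see context). Let $\check X_{N,\rho,\epsilon}(\tilde\xi^N)$ be the $\epsilon$-optimal solution set of the algorithm-augmented compromise decision problem and $X^*_\epsilon$ that of the true problem. If $\epsilon\le\epsilon_1$, then: 1. $$\mathrm{Var}\big[\Delta(\check X_{N,\rho,\epsilon}(\tilde\xi^N),X^*_\epsilon)\big]\le\frac{64D_X^2M_FN_F}{m\,\epsilon^2n^\lambda}+\Big(\frac{8D_XN_F}{\epsilon n^\lambda}+\frac{(\tau_1+\tau_2)D_X}{\epsilon}+2\sqrt{\epsilon/\rho}\Big)^2,$$ where $\tau_1=\epsilon_1-\epsilon$ and $\tau_2=\epsilon_1+\frac{m-1}m\epsilon_2-\epsilon$. 2. Furthermore, let $K_1$ be a positive constant. For $\epsilon_1=\epsilon$, $\epsilon_2=0$ and $\rho\ge K_1n$, $$\mathbb E\big[\Delta(\check X_{N,\rho,\epsilon}(\tilde\xi^N),X^*_\epsilon)\big]=O\Big(\frac1{n^\lambda}\Big),\qquad\mathrm{Var}\big[\Delta(\check X_{N,\rho,\epsilon}(\tilde\xi^N),X^*_\epsilon)\big]=O\Big(\frac1{mn^\lambda}+\frac1{n^{2\lambda}}\Big),$$ where the implied constants do not depend on $n$ and $m$ (the problem data, $\epsilon$, $\lambda$, $K_1$ bei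ng fixed).
   Context: $\tilde\xi$ is a random vector on a probability space with values in $\Xi\subset\mathbb R^d$. $X\subset\mathbb R^p$ is a nonempty compact convex set contained in a cube of edge length $D$; $D_X=\max_{x,x'\in X}\|x-x'\|$, with $\|\cdot\|$ the Euclidean norm. $F:X\times\Xi\to\mathbb R$ is a Carathéodory function (continuous in $x$, measurable in $\xi$) such that: (i) for some $L_F$ and $\gamma\in(0,1]$, $|F(x,\xi)-F(y,\xi)|\le L_F\|x-y\|^\gamma$ for all $x,y\in X$, $\xi\in\Xi$; (ii) for some $M_F\in(0,\infty)$, $\sup_{x\in X,\xi\in\Xi}|F(x,\xi)|<M_F$; (iii) $F(\cdot,\xi)$ is convex on $X$ for every $\xi\in\Xi$. True problem: $f(x)=\mathbb E[F(x,\tilde\xi)]$, $\theta^*=\min_{x\in X}f(x)$, $X^*_\epsilon=\{x\in X:f(x)\le\theta^*+\epsilon\}$. Sampling: $\tilde\xi_1,\dots,\tilde\xi_N$ ($N=mn$) are i.i.d. copies of $\tilde\xi$; $\tilde\xi^N$ is the whole sample and $\tilde\xi^n_i=\{\tilde\xi_{(i-1)n+1},\dots,\tilde\xi_{in}\}$ the sample of replication $i$; untilded symbols are realizations. $f_n(x;\xi^n_i)=\frac1n\sum_{j=1}^nF(x,\xi_{(i-1)n+j})$. Algorithm output: for each replication $i$ an algorithm returns a function $\hat f_n(\cdot;\xi^n_i)$ and a point $\hat x_n(\xi^n_i)\in X$. Outer Approximation Condition: $\hat f_n(x;\xi^n_i)=\max_{\ell\in L}\{\alpha_\ell+\langle\beta_\ell,x\rangle\}$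 (finite index set $L$) and $\hat f_n(x;\xi^n_i)\le f_n(x;\xi^n_i)$ for all $x\in X$. Termination Condition: $\hat x_n(\xi^n_i)\in\arg\min_{x\in X}\hat f_n(x;\xi^n_i)$ and $f_n(\hat x_n(\xi^n_i);\xi^n_i)-\hat f_n(\hat x_n(\xi^n_i);\xi^n_i)\le\epsilon_1$. Augmentation: $$\check f_n(x;\xi^n_i)=\max\Big\{\hat f_n(x;\xi^n_i),\ \max_{j=1,\dots,m}\big\{f_n(\hat x_n(\xi^n_j);\xi^n_i)+\langle\upsilon_{ij},x-\hat x_n(\xi^n_j)\rangle-\epsilon_2\big\}\Big\},$$ where $\upsilon_{ij}$ is an $\epsilon_2$-subgradient of $f_n(\cdot;\xi^n_i)$ at $\hat x_n(\xi^n_j)$, i.e. $f_n(y;\xi^n_i)\ge f_n(\hat x_n(\xi^n_j);\xi^n_i)+\langle\upsilon_{ij},y-\hat x_n(\xi^n_j)\rangle-\epsilon_2$ for all $y\in X$ (such vectors are given). Algorithm-augmented compromise decision problem: minimize over $x\in X$ the function $G(x)=\frac1m\sum_{i=1}^m\check f_n(x;\xi^n_i)+\frac\rho2\big\|x-\frac1m\sum_{j=1}^m\hat x_n(\xi^n_j)\big\|^2$; $\check X_{N,\rho,\epsilon}(\xi^N)=\{x\in X:G(x)\le\min_XG+\epsilon\}$. Pessimistic distance: $\Delta(A,B)=\sup_{a\in A}\inf_{b\in B}\|a-b\|$. Constant: $N_F=L_FD^\gamma p^{\gamma/2}+M_F\sqrt{2\log2}+\dfrac{M_Fp^{1/2}}{\sqrt{\gamma(1-2\lambda)e}}$.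 All selections and random quantities whose expectation or variance is taken are assumed measurable. *)

theory Defs
  imports "HOL-Probability.Probability"
begin

text \<open>Problem data: the decision space is \<open>real^'p\<close> (so the dimension is \<open>CARD('p)\<close>), the
  random vector takes values in \<open>\<Xi>\<close>, a (not necessarily measurable) subset of \<open>real^'d\<close>;
  measurability of the integrand in its second argument is with respect to the trace Borel
  sigma-algebra on \<open>\<Xi>\<close>.\<close>

locale stochastic_program = prob_space P
  for P :: "'w measure" +
  fixes \<xi> :: "'w \<Rightarrow> real^'d"
    and \<Xi> :: "(real^'d) set"
    and X :: "(real^'p) set"
    and F :: "real^'p \<Rightarrow> real^'d \<Rightarrow> real"
    and D L\<^sub>F \<gamma> M\<^sub>F :: real
  assumes xi_measurable: "\<xi> \<in> borel_measurable P"
    and xi_range: "\<xi> \<in> space P \<rightarrow> \<Xi>"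
    and X_nonempty: "X \<noteq> {}"
    and X_compact: "compact X"
    and X_convex: "convex X"
    and X_cube: "\<exists>a. X \<subseteq> {x. \<forall>i. a $ i \<le> x $ i \<and> x $ i \<le> a $ i + D}"
    and F_continuous: "y \<in> \<Xi> \<Longrightarrow> continuous_on X (\<lambda>x. F x y)"
    and F_measurable: "x \<in> X \<Longrightarrow> F x \<in> borel_measurable (restrict_space borel \<Xi>)"
    and gamma: "0 < \<gamma>" "\<gamma> \<le> 1"
    and F_hoelder: "\<lbrakk>x \<in> X; x' \<in> X; y \<in> \<Xi>\<rbrakk> \<Longrightarrow>
      \<bar>F x y - F x' y\<bar> \<le> L\<^sub>F * norm (x - x') powr \<gamma>"
    and M_F_pos: "0 < M\<^sub>F"
    and F_bounded: "bdd_above ((\<lambda>(x, y). \<bar>F x y\<bar>) ` (X \<times> \<Xi>))"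
      "(SUP (x, y)\<in>X \<times> \<Xi>. \<bar>F x y\<bar>) < M\<^sub>F"
    and F_convex: "y \<in> \<Xi> \<Longrightarrow> convex_on X (\<lambda>x. F x y)"

definition true_obj ::
    "'w measure \<Rightarrow> ('w \<Rightarrow> real^'d) \<Rightarrow> (real^'p \<Rightarrow> real^'d \<Rightarrow> real) \<Rightarrow> real^'p \<Rightarrow> real" where
  "true_obj P \<xi> F x = (\<integral>\<omega>. F x (\<xi> \<omega>) \<partial>P)"

text \<open>The objectives to which the next definition is applied are continuous on the compact set
  \<open>X\<close>, so that the infimum is the minimum.\<close>

definition eps_opt :: "(real^'p) set \<Rightarrow> (real^'p \<Rightarrow> real) \<Rightarrow> real \<Rightarrow> (real^'p) set" where
  "eps_opt X g \<epsilon> = {x \<in> X. g x \<le> (INF y\<in>X. g y) + \<epsilon>}"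

definition pess_dist :: "(real^'p) set \<Rightarrow> (real^'p) set \<Rightarrow> real" where
  "pess_dist A B = (SUP a\<in>A. INF b\<in>B. norm (a - b))"

text \<open>A realised sample of size \<open>N\<close> is an extensional function on \<open>{1..N}\<close>; the replications
  are numbered from 1.\<close>

definition whole_sample :: "nat \<Rightarrow> (nat \<Rightarrow> 'w \<Rightarrow> real^'d) \<Rightarrow> 'w \<Rightarrow> nat \<Rightarrow> real^'d" where
  "whole_sample N \<xi>s \<omega> = (\<lambda>k\<in>{1..N}. \<xi>s k \<omega>)"

definition replication :: "nat \<Rightarrow> (nat \<Rightarrow> real^'d) \<Rightarrow> nat \<Rightarrow> nat \<Rightarrow> real^'d" where
  "replication n s i = (\<lambda>j\<in>{1..n}. s ((i - 1) * n + j))"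

definition iid_copies :: "'w measure \<Rightarrow> ('w \<Rightarrow> real^'d) \<Rightarrow> (real^'d) set \<Rightarrow> nat \<Rightarrow>
    (nat \<Rightarrow> 'w \<Rightarrow> real^'d) \<Rightarrow> bool" where
  "iid_copies P \<xi> \<Xi> N \<xi>s \<longleftrightarrow>
     prob_space.indep_vars P (\<lambda>_. borel) \<xi>s {1..N} \<and>
     (\<forall>k\<in>{1..N}. distr P borel (\<xi>s k) = distr P borel \<xi> \<and> \<xi>s k \<in> space P \<rightarrow> \<Xi>)"

definition saa :: "(real^'p \<Rightarrow> real^'d \<Rightarrow> real) \<Rightarrow> nat \<Rightarrow> (nat \<Rightarrow> real^'d) \<Rightarrow> real^'p \<Rightarrow> real" where
  "saa F n r x = (\<Sum>j=1..n. F x (r j)) / real n"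

definition outer_approximation ::
    "(real^'p) set \<Rightarrow> (real^'p \<Rightarrow> real) \<Rightarrow> (real^'p \<Rightarrow> real) \<Rightarrow> bool" where
  "outer_approximation X g ghat \<longleftrightarrow>
     (\<exists>(L :: nat set) \<alpha> \<beta>. finite L \<and> L \<noteq> {} \<and>
        (\<forall>x\<in>X. ghat x = Max ((\<lambda>l. \<alpha> l + \<beta> l \<bullet> x) ` L))) \<and>
     (\<forall>x\<in>X. ghat x \<le> g x)"

definition termination_condition ::
    "(real^'p) set \<Rightarrow> (real^'p \<Rightarrow> real) \<Rightarrow> (real^'p \<Rightarrow> real) \<Rightarrow> real^'p \<Rightarrow> real \<Rightarrow> bool" where
  "termination_condition X g ghat z \<epsilon>\<^sub>1 \<longleftrightarrow>
     is_arg_min ghat (\<lambda>x. x \<in> X) z \<and> g z - ghat z \<le> \<epsilon>\<^sub>1"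

definition eps_subgradient ::
    "(real^'p) set \<Rightarrow> (real^'p \<Rightarrow> real) \<Rightarrow> real^'p \<Rightarrow> real^'p \<Rightarrow> real \<Rightarrow> bool" where
  "eps_subgradient X g z v \<epsilon>\<^sub>2 \<longleftrightarrow> (\<forall>y\<in>X. g y \<ge> g z + v \<bullet> (y - z) - \<epsilon>\<^sub>2)"

text \<open>In what follows \<open>fhat\<close> and \<open>xhat\<close> are the outputs of the algorithm as functions of the
  sample of a single replication, and \<open>\<upsilon> i j\<close> is a function of the whole sample \<open>s\<close>, since it
  depends on the samples of both the \<open>i\<close>-th and the \<open>j\<close>-th replication.\<close>

definition augmented_approx ::
    "(real^'p \<Rightarrow> real^'d \<Rightarrow> real) \<Rightarrow> nat \<Rightarrow> nat \<Rightarrow>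
     ((nat \<Rightarrow> real^'d) \<Rightarrow> real^'p \<Rightarrow> real) \<Rightarrow> ((nat \<Rightarrow> real^'d) \<Rightarrow> real^'p) \<Rightarrow>
     (nat \<Rightarrow> nat \<Rightarrow> (nat \<Rightarrow> real^'d) \<Rightarrow> real^'p) \<Rightarrow> real \<Rightarrow>
     (nat \<Rightarrow> real^'d) \<Rightarrow> nat \<Rightarrow> real^'p \<Rightarrow> real" where
  "augmented_approx F m n fhat xhat \<upsilon> \<epsilon>\<^sub>2 s i x =
     max (fhat (replication n s i) x)
       (Max ((\<lambda>j. let z = xhat (replication n s j) in
                saa F n (replication n s i) z + \<upsilon> i j s \<bullet> (x - z) - \<epsilon>\<^sub>2) ` {1..m}))"

definition compromise_obj ::
    "(real^'p \<Rightarrow> real^'d \<Rightarrow> real) \<Rightarrow> nat \<Rightarrow> nat \<Rightarrow>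
     ((nat \<Rightarrow> real^'d) \<Rightarrow> real^'p \<Rightarrow> real) \<Rightarrow> ((nat \<Rightarrow> real^'d) \<Rightarrow> real^'p) \<Rightarrow>
     (nat \<Rightarrow> nat \<Rightarrow> (nat \<Rightarrow> real^'d) \<Rightarrow> real^'p) \<Rightarrow> real \<Rightarrow> real \<Rightarrow>
     (nat \<Rightarrow> real^'d) \<Rightarrow> real^'p \<Rightarrow> real" where
  "compromise_obj F m n fhat xhat \<upsilon> \<epsilon>\<^sub>2 \<rho> s x =
     (\<Sum>i=1..m. augmented_approx F m n fhat xhat \<upsilon> \<epsilon>\<^sub>2 s i x) / real m +
     \<rho> / 2 * (norm (x - (1 / real m) *\<^sub>R (\<Sum>j=1..m. xhat (replication n s j))))\<^sup>2"

definition compromise_dist ::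
    "'w measure \<Rightarrow> ('w \<Rightarrow> real^'d) \<Rightarrow> (real^'p) set \<Rightarrow> (real^'p \<Rightarrow> real^'d \<Rightarrow> real) \<Rightarrow>
     nat \<Rightarrow> nat \<Rightarrow> (nat \<Rightarrow> 'w \<Rightarrow> real^'d) \<Rightarrow>
     ((nat \<Rightarrow> real^'d) \<Rightarrow> real^'p \<Rightarrow> real) \<Rightarrow> ((nat \<Rightarrow> real^'d) \<Rightarrow> real^'p) \<Rightarrow>
     (nat \<Rightarrow> nat \<Rightarrow> (nat \<Rightarrow> real^'d) \<Rightarrow> real^'p) \<Rightarrow> real \<Rightarrow> real \<Rightarrow> real \<Rightarrow> 'w \<Rightarrow> real" where
  "compromise_dist P \<xi> X F m n \<xi>s fhat xhat \<upsilon> \<epsilon>\<^sub>2 \<rho> \<epsilon> \<omega> =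
     pess_dist
       (eps_opt X (compromise_obj F m n fhat xhat \<upsilon> \<epsilon>\<^sub>2 \<rho> (whole_sample (m * n) \<xi>s \<omega>)) \<epsilon>)
       (eps_opt X (true_obj P \<xi> F) \<epsilon>)"

text \<open>The next predicate collects the hypotheses on the sample, on the algorithm output in each
  replication, and on the given \<open>\<epsilon>\<^sub>2\<close>-subgradients.  They are required for every outcome
  \<open>\<omega>\<close>.\<close>

definition algorithm_run ::
    "'w measure \<Rightarrow> ('w \<Rightarrow> real^'d) \<Rightarrow> (real^'d) set \<Rightarrow> (real^'p) set \<Rightarrow>
     (real^'p \<Rightarrow> real^'d \<Rightarrow> real) \<Rightarrow> nat \<Rightarrow> nat \<Rightarrow> (nat \<Rightarrow> 'w \<Rightarrow> real^'d) \<Rightarrow>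
     ((nat \<Rightarrow> real^'d) \<Rightarrow> real^'p \<Rightarrow> real) \<Rightarrow> ((nat \<Rightarrow> real^'d) \<Rightarrow> real^'p) \<Rightarrow>
     (nat \<Rightarrow> nat \<Rightarrow> (nat \<Rightarrow> real^'d) \<Rightarrow> real^'p) \<Rightarrow> real \<Rightarrow> real \<Rightarrow> bool" where
  "algorithm_run P \<xi> \<Xi> X F m n \<xi>s fhat xhat \<upsilon> \<epsilon>\<^sub>1 \<epsilon>\<^sub>2 \<longleftrightarrow>
     iid_copies P \<xi> \<Xi> (m * n) \<xi>s \<and>
     (\<forall>\<omega>\<in>space P. \<forall>i\<in>{1..m}.
        let s = whole_sample (m * n) \<xi>s \<omega>; r = replication n s i in
          outer_approximation X (saa F n r) (fhat r) \<and>
          termination_condition X (saa F n r) (fhat r) (xhat r) \<epsilon>\<^sub>1 \<and>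
          (\<forall>j\<in>{1..m}. eps_subgradient X (saa F n r) (xhat (replication n s j)) (\<upsilon> i j s) \<epsilon>\<^sub>2)) \<and>
     (\<forall>i\<in>{1..m}.
        (\<lambda>\<omega>. xhat (replication n (whole_sample (m * n) \<xi>s \<omega>) i)) \<in> borel_measurable P \<and>
        (\<forall>j\<in>{1..m}. (\<lambda>\<omega>. \<upsilon> i j (whole_sample (m * n) \<xi>s \<omega>)) \<in> borel_measurable P))"

definition N_const :: "nat \<Rightarrow> real \<Rightarrow> real \<Rightarrow> real \<Rightarrow> real \<Rightarrow> real \<Rightarrow> real" where
  "N_const p D L\<^sub>F \<gamma> M\<^sub>F lam =
     L\<^sub>F * D powr \<gamma> * real p powr (\<gamma> / 2) + M\<^sub>F * sqrt (2 * ln 2) +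
     M\<^sub>F * sqrt (real p) / sqrt (\<gamma> * (1 - 2 * lam) * exp 1)"

end

theory Submission
  imports Defs
begin

text \<open>Let \<open>\<delta> i\<close> dominate the uniform error \<open>sup\<^sub>x \<bar>f\<^sub>n(x; \<xi>\<^sub>i) - f(x)\<bar>\<close> of replication \<open>i\<close> and let
  \<open>a\<close> be the average of the \<open>\<delta> i\<close>.  Deterministically, the average of the replication solutions is
  \<open>(\<epsilon>\<^sub>1 + 2 a)\<close>-optimal for the convex function \<open>f\<close>, hence near the \<open>\<epsilon>\<close>-optimal set, and the
  proximal term keeps every \<open>\<epsilon>\<close>-optimal compromise decision near that average.  This bounds the
  pessimistic distance by an affine function of \<open>a\<close>, with slope \<open>4 D\<^sub>X / \<epsilon>\<close>.  The \<open>\<delta> i\<close> are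
  independent, lie between \<open>0\<close> and \<open>2 M\<^sub>F\<close>, and have mean at most \<open>2 N\<^sub>F / n\<^sup>\<lambda>\<close>, which controls
  the second moment of \<open>a\<close>.  The bound on the mean needs no symmetrisation: on a finite net of \<open>X\<close>
  it follows from Hoeffding's lemma, which is better by a factor \<open>2\<close> than the Rademacher bound, and
  this slack absorbs the rounding of the mesh size.\<close>

subsection \<open>Moments of means and maxima\<close>

text \<open>Boundedness makes the exponential integrable, so Hoeffding's lemma, given for the
  nonnegative integral, carries over to the Bochner integral.\<close>

lemma (in interval_bounded_random_variable) expectation_exp_centered_le:
  assumes "l > 0"
  shows "expectation (\<lambda>x. exp (l * (f x - expectation f))) \<le> exp (l\<^sup>2 * (b - a)\<^sup>2 / 8)"
proof -
  have "AE x in M. norm (exp (l * (f x - expectation f))) \<le> exp (l * (b - expectation f))"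
    using AE_in_interval by eventually_elim (use assms in auto)
  hence "integrable M (\<lambda>x. exp (l * (f x - expectation f)))"
    by (intro integrable_const_bound) auto
  hence "ennreal (expectation (\<lambda>x. exp (l * (f x - expectation f)))) =
      (\<integral>\<^sup>+x. exp (l * (f x - expectation f)) \<partial>M)"
    by (intro nn_integral_eq_integral [symmetric]) auto
  also have "\<dots> \<le> ennreal (exp (l\<^sup>2 * (b - a)\<^sup>2 / 8))"
    by (rule Hoeffdings_lemma_nn_integral) fact
  finally show ?thesis
    by (subst (asm) ennreal_le_iff) auto
qed

text \<open>Independence factorises the exponential of the sum. Each variable lives on an interval
  of width \<open>2 * B\<close>, and Hoeffding's lemma with parameter \<open>l / card I\<close>
  applies to each factor. The product says that the centred mean is sub-Gaussian with variance proxy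
  \<open>B\<^sup>2 / card I\<close>.\<close>

lemma (in prob_space) expectation_exp_mean_le:
  fixes Y :: "'i \<Rightarrow> 'a \<Rightarrow> real"
  assumes I: "finite I" "I \<noteq> {}"
    and indep: "indep_vars (\<lambda>_. borel) Y I"
    and bound: "\<And>i \<omega>. i \<in> I \<Longrightarrow> \<omega> \<in> space M \<Longrightarrow> \<bar>Y i \<omega>\<bar> \<le> B"
    and mean: "\<And>i. i \<in> I \<Longrightarrow> expectation (Y i) = \<mu>"
    and "l > 0"
  shows "expectation (\<lambda>\<omega>. exp (l * ((\<Sum>i\<in>I. Y i \<omega>) / card I - \<mu>))) \<le> exp (l\<^sup>2 * (B\<^sup>2 / card I) / 2)"
proof -
  define n where "n = real (card I)"
  have n: "n > 0" using I by (simp add: n_def card_gt_0_iff)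
  interpret indep_interval_bounded_random_variables M I Y "\<lambda>_. - B" "\<lambda>_. B"
  proof unfold_locales
    fix i assume "i \<in> I"
    then show "AE x in M. Y i x \<in> {-B..B}"
      using bound by (intro AE_I2) (auto simp: abs_le_iff minus_le_iff)
  qed (use I indep in auto)
  have eq: "exp (l * ((\<Sum>i\<in>I. Y i \<omega>) / card I - \<mu>)) = (\<Prod>i\<in>I. exp (l / n * (Y i \<omega> - \<mu>)))" for \<omega>
  proof -
    have "l * ((\<Sum>i\<in>I. Y i \<omega>) / card I - \<mu>) = l / n * ((\<Sum>i\<in>I. Y i \<omega>) - n * \<mu>)"
      using n by (simp add: n_def [symmetric] field_simps)
    also have "\<dots> = (\<Sum>i\<in>I. l / n * (Y i \<omega> - \<mu>))"
      unfolding sum_distrib_left [symmetric] by (simp add: sum_subtractf n_def)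
    finally show ?thesis using I by (simp add: exp_sum)
  qed
  have indep': "indep_vars (\<lambda>_. borel) (\<lambda>i \<omega>. exp (l / n * (Y i \<omega> - \<mu>))) I"
    by (rule indep_vars_compose2 [OF indep]) auto
  have int: "integrable M (\<lambda>\<omega>. exp (l / n * (Y i \<omega> - \<mu>)))" if i: "i \<in> I" for i
  proof (rule integrable_const_bound)
    show "AE x in M. norm (exp (l / n * (Y i x - \<mu>))) \<le> exp (l / n * (B - \<mu>))"
      using AE_in_interval [OF i] by eventually_elim (use n \<open>l > 0\<close> in \<open>auto simp: divide_right_mono\<close>)
  qed (use random_variable [OF i] in measurable)
  have "expectation (\<lambda>\<omega>. exp (l * ((\<Sum>i\<in>I. Y i \<omega>) / card I - \<mu>))) =
      (\<Prod>i\<in>I. expectation (\<lambda>\<omega>. exp (l / n * (Y i \<omega> - \<mu>))))"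
    unfolding eq by (rule indep_vars_lebesgue_integral [OF I(1) indep' int])
  also have "\<dots> \<le> (\<Prod>i\<in>I. exp ((l / n)\<^sup>2 * (B - - B)\<^sup>2 / 8))"
  proof (intro prod_mono conjI)
    fix i assume i: "i \<in> I"
    then interpret i: interval_bounded_random_variable M "Y i" "- B" B ..
    show "expectation (\<lambda>\<omega>. exp (l / n * (Y i \<omega> - \<mu>))) \<le> exp ((l / n)\<^sup>2 * (B - - B)\<^sup>2 / 8)"
      using i.expectation_exp_centered_le [of "l / n"] \<open>l > 0\<close> n mean [OF i] by simp
  qed (auto intro: integral_nonneg_AE)
  also have "\<dots> = exp (l\<^sup>2 * (B\<^sup>2 / card I) / 2)"
    using n by (simp add: exp_of_nat_mult [symmetric] n_def [symmetric])
      (simp add: field_simps power2_eq_square n_def)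
  finally show ?thesis .
qed

text \<open>The maximal inequality for sub-Gaussian variables, which may depend on each other: the
  exponential of the maximum is at most a sum of \<open>2 * card S\<close> exponentials. In place of
  Jensen's inequality for the logarithm, its tangent at \<open>c\<close> is used, so that the
  pointwise bound is already linear in the exponentials. The hypothesis \<open>bound\<close>
  supplies integrability.\<close>

lemma (in prob_space) expectation_Max_abs_le:
  fixes W :: "'i \<Rightarrow> 'a \<Rightarrow> real"
  assumes S: "finite S" "S \<noteq> {}"
    and rv: "\<And>y. y \<in> S \<Longrightarrow> random_variable borel (W y)"
    and bound: "\<And>y \<omega>. y \<in> S \<Longrightarrow> \<omega> \<in> space M \<Longrightarrow> \<bar>W y \<omega>\<bar> \<le> B"
    and "v > 0"
    and exp_pos: "\<And>y l. y \<in> S \<Longrightarrow> l > 0 \<Longrightarrow> expectation (\<lambda>\<omega>. exp (l * W y \<omega>)) \<le> exp (l\<^sup>2 * v / 2)"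
    and exp_neg: "\<And>y l. y \<in> S \<Longrightarrow> l > 0 \<Longrightarrow> expectation (\<lambda>\<omega>. exp (- l * W y \<omega>)) \<le> exp (l\<^sup>2 * v / 2)"
  shows "expectation (\<lambda>\<omega>. Max ((\<lambda>y. \<bar>W y \<omega>\<bar>) ` S)) \<le> sqrt (2 * v * ln (2 * real (card S)))"
proof -
  define N where "N = 2 * real (card S)"
  have "card S > 0" using S by (simp add: card_gt_0_iff)
  hence N: "N > 1" by (simp add: N_def)
  \<comment> \<open>This value minimises \<open>ln N / l + l * v / 2\<close>, the bound that
    parameter \<open>l\<close> gives.\<close>
  define l where "l = sqrt (2 * ln N / v)"
  have l: "l > 0" "l\<^sup>2 = 2 * ln N / v"
    using N \<open>v > 0\<close> by (auto simp: l_def)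
  \<comment> \<open>\<open>c\<close> bounds the expected sum of exponentials. After integration the
    quotient by \<open>c\<close> is therefore at most \<open>1\<close> and cancels the
    \<open>- 1\<close> of the tangent.\<close>
  define c where "c = N * exp (l\<^sup>2 * v / 2)"
  have c: "c > 0" using N by (simp add: c_def)
  let ?m = "\<lambda>\<omega>. Max ((\<lambda>y. \<bar>W y \<omega>\<bar>) ` S)"
  have rvm: "random_variable borel ?m"
    using S rv by (intro borel_measurable_Max) auto
  have m_bound: "\<bar>?m \<omega>\<bar> \<le> B" if "\<omega> \<in> space M" for \<omega>
  proof -
    have "?m \<omega> \<in> (\<lambda>y. \<bar>W y \<omega>\<bar>) ` S"
      using S by (intro Max_in) auto
    then show ?thesis using bound that by auto
  qed
  have intm: "integrable M ?m"
    by (rule integrable_const_bound [OF AE_I2, where B = B]) (use m_bound rvm in auto)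
  have int1: "integrable M (\<lambda>\<omega>. exp (k * W y \<omega>))" if "y \<in> S" for y k
  proof (rule integrable_const_bound [OF AE_I2, where B = "exp (\<bar>k\<bar> * B)"])
    fix \<omega> assume "\<omega> \<in> space M"
    hence "\<bar>k * W y \<omega>\<bar> \<le> \<bar>k\<bar> * B"
      unfolding abs_mult using bound that by (intro mult_left_mono) auto
    then show "norm (exp (k * W y \<omega>)) \<le> exp (\<bar>k\<bar> * B)" by auto
  qed (use rv [OF that] in measurable)
  have pointwise: "l * ?m \<omega> \<le> ln c - 1 + (\<Sum>y\<in>S. exp (l * W y \<omega>) + exp (- l * W y \<omega>)) / c" for \<omega>
  proof -
    have "?m \<omega> \<in> (\<lambda>y. \<bar>W y \<omega>\<bar>) ` S"
      using S by (intro Max_in) auto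
    then obtain y where y: "y \<in> S" "?m \<omega> = \<bar>W y \<omega>\<bar>" by auto
    have "1 + (l * ?m \<omega> - ln c) \<le> exp (l * ?m \<omega> - ln c)"
      by (rule exp_ge_add_one_self)
    also have "\<dots> = exp (l * ?m \<omega>) / c"
      using c by (simp add: exp_diff)
    also have "exp (l * ?m \<omega>) \<le> exp (l * W y \<omega>) + exp (- l * W y \<omega>)"
      unfolding y(2) by (cases "W y \<omega> \<ge> 0") (auto simp: abs_if)
    also have "\<dots> \<le> (\<Sum>y\<in>S. exp (l * W y \<omega>) + exp (- l * W y \<omega>))"
      using S y by (intro member_le_sum) (auto intro: add_nonneg_nonneg)
    finally show ?thesis using c by (simp add: divide_right_mono)
  qed
  have "l * expectation ?m = expectation (\<lambda>\<omega>. l * ?m \<omega>)" by simp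
  also have "\<dots> \<le> expectation (\<lambda>\<omega>. ln c - 1 + (\<Sum>y\<in>S. exp (l * W y \<omega>) + exp (- l * W y \<omega>)) / c)"
    by (intro integral_mono pointwise Bochner_Integration.integrable_add integrable_const
        integrable_mult_right Bochner_Integration.integrable_sum int1 intm integrable_divide_zero) auto
  also have "\<dots> = ln c - 1 + (\<Sum>y\<in>S. expectation (\<lambda>\<omega>. exp (l * W y \<omega>)) +
      expectation (\<lambda>\<omega>. exp (- l * W y \<omega>))) / c"
    using int1 int1 [of _ "- l"] by (simp add: prob_space)
  also have "\<dots> \<le> ln c - 1 + (\<Sum>y\<in>S. exp (l\<^sup>2 * v / 2) + exp (l\<^sup>2 * v / 2)) / c"
    using c l by (intro add_left_mono divide_right_mono sum_mono add_mono exp_pos exp_neg) auto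
  also have "\<dots> = ln c"
    using c N by (simp add: c_def N_def)
  also have "\<dots> = 2 * ln N"
    using N \<open>v > 0\<close> by (simp add: c_def ln_mult l)
  finally have "expectation ?m \<le> 2 * ln N / l"
    using l(1) by (simp add: field_simps)
  also have "\<dots> = l * v"
    using l \<open>v > 0\<close> by (simp add: field_simps power2_eq_square)
  also have "\<dots> = sqrt (2 * v * ln N)"
  proof (rule real_sqrt_unique [symmetric])
    show "(l * v)\<^sup>2 = 2 * v * ln N"
      unfolding power_mult_distrib l(2) using \<open>v > 0\<close> by (simp add: power2_eq_square)
  qed (use l \<open>v > 0\<close> in auto)
  finally show ?thesis by (simp add: N_def)
qed

text \<open>Expanding the square of the average, only the diagonal terms see the range of the variables;
  by independence the others factorise.\<close>

lemma (in prob_space) expectation_square_mean_le: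
  fixes Y :: "'i \<Rightarrow> 'a \<Rightarrow> real"
  assumes I: "finite I" "I \<noteq> {}"
    and indep: "indep_vars (\<lambda>_. borel) Y I"
    and range: "\<And>i \<omega>. i \<in> I \<Longrightarrow> \<omega> \<in> space M \<Longrightarrow> 0 \<le> Y i \<omega> \<and> Y i \<omega> \<le> B"
    and mean: "\<And>i. i \<in> I \<Longrightarrow> expectation (Y i) \<le> e"
  shows "expectation (\<lambda>\<omega>. ((\<Sum>i\<in>I. Y i \<omega>) / card I)\<^sup>2) \<le> B * e / card I + e\<^sup>2"
proof -
  define n where "n = real (card I)"
  have n: "n \<ge> 1" using I by (simp add: n_def card_gt_0_iff Suc_le_eq)
  have rv: "random_variable borel (Y i)" if "i \<in> I" for i
    using indep that by (auto simp: indep_vars_def)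
  have int: "integrable M (Y i)" if "i \<in> I" for i
    by (rule integrable_const_bound [OF AE_I2, where B = B]) (use range that rv in auto)
  have int2: "integrable M (\<lambda>\<omega>. Y i \<omega> * Y j \<omega>)" if "i \<in> I" "j \<in> I" for i j
  proof (rule integrable_const_bound [OF AE_I2, where B = "B * B"])
    fix \<omega> assume "\<omega> \<in> space M"
    then show "norm (Y i \<omega> * Y j \<omega>) \<le> B * B"
      using range [OF that(1)] range [OF that(2)] by (auto simp: abs_mult intro!: mult_mono) force
  qed (use rv that in measurable)
  have nonneg: "0 \<le> expectation (Y i)" if "i \<in> I" for i
    using range that by (intro integral_nonneg_AE AE_I2) auto
  have B: "0 \<le> B"
    using I range not_empty by (meson all_not_in_conv order_trans)
  have diag: "expectation (\<lambda>\<omega>. Y i \<omega> * Y i \<omega>) \<le> B * e" if "i \<in> I" for i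
  proof -
    have "expectation (\<lambda>\<omega>. Y i \<omega> * Y i \<omega>) \<le> expectation (\<lambda>\<omega>. B * Y i \<omega>)"
      using range that by (intro integral_mono int2 integrable_mult_right int mult_right_mono) auto
    also have "\<dots> = B * expectation (Y i)" by simp
    also have "\<dots> \<le> B * e" using mean that B by (intro mult_left_mono) auto
    finally show ?thesis .
  qed
  have off: "expectation (\<lambda>\<omega>. Y i \<omega> * Y j \<omega>) \<le> e\<^sup>2" if ij: "i \<in> I" "j \<in> I" "i \<noteq> j" for i j
  proof -
    have "indep_vars (\<lambda>_. borel) Y {i, j}"
      using indep by (rule indep_vars_subset) (use ij in auto)
    then have "expectation (\<lambda>\<omega>. \<Prod>k\<in>{i, j}. Y k \<omega>) = (\<Prod>k\<in>{i, j}. expectation (Y k))"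
      by (intro indep_vars_lebesgue_integral) (use ij int in auto)
    then have "expectation (\<lambda>\<omega>. Y i \<omega> * Y j \<omega>) = expectation (Y i) * expectation (Y j)"
      using ij by simp
    also have "\<dots> \<le> e * e"
      using mean ij nonneg by (intro mult_mono) (auto intro: order_trans)
    finally show ?thesis by (simp add: power2_eq_square)
  qed
  have "expectation (\<lambda>\<omega>. ((\<Sum>i\<in>I. Y i \<omega>) / card I)\<^sup>2) =
      (\<Sum>i\<in>I. \<Sum>j\<in>I. expectation (\<lambda>\<omega>. Y i \<omega> * Y j \<omega>)) / n\<^sup>2"
    using int2 by (simp add: n_def power_divide power2_eq_square [of "sum _ _"] sum_product)
  \<comment> \<open>Granting \<open>e\<^sup>2\<close> to the diagonal terms as well makes the double
    sum a constant plus a diagonal contribution of weight \<open>n\<close>.\<close>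
  also have "\<dots> \<le> (\<Sum>i\<in>I. \<Sum>j\<in>I. e\<^sup>2 + (if i = j then B * e else 0)) / n\<^sup>2"
    using diag off by (intro divide_right_mono sum_mono) (auto intro: add_increasing)
  also have "\<dots> = (n * (n * e\<^sup>2 + B * e)) / n\<^sup>2"
    using I by (simp add: sum.distrib n_def algebra_simps)
  also have "\<dots> = B * e / n + e\<^sup>2"
    using n by (simp add: field_simps power2_eq_square)
  finally show ?thesis by (simp add: n_def)
qed

subsection \<open>Covering numbers and the choice of the mesh\<close>

lemma cube_edge_nonneg:
  fixes X :: "(real^'p) set"
  assumes "X \<subseteq> {x. \<forall>i. a $ i \<le> x $ i \<and> x $ i \<le> a $ i + D}" "X \<noteq> {}"
  shows "0 \<le> D"
proof -
  obtain x where "x \<in> X" using assms by auto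
  then have "a $ undefined \<le> x $ undefined \<and> x $ undefined \<le> a $ undefined + D"
    using assms by auto
  then show ?thesis by linarith
qed

text \<open>The cube is cut into \<open>k ^ CARD('p)\<close> cells of edge \<open>D / k\<close>, and
  each cell that meets \<open>X\<close> contributes one of its points in \<open>X\<close>. Cell
  centres could lie outside \<open>X\<close>, where nothing is assumed about the integrand; the
  price is a radius of a whole cell diagonal.\<close>

lemma cube_cover:
  fixes X :: "(real^'p) set" and k :: nat
  assumes X: "X \<subseteq> {x. \<forall>i. a $ i \<le> x $ i \<and> x $ i \<le> a $ i + D}" "X \<noteq> {}" and k: "k \<ge> 1"
  obtains S where "finite S" "S \<noteq> {}" "S \<subseteq> X" "card S \<le> k ^ CARD('p)"
    "\<And>x. x \<in> X \<Longrightarrow> \<exists>y\<in>S. norm (x - y) \<le> D * sqrt CARD('p) / k"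
proof -
  have D: "D \<ge> 0" by (rule cube_edge_nonneg [OF X])
  define cell where "cell c x \<longleftrightarrow> x \<in> X \<and> (\<forall>i. a $ i + real (c i) * (D / k) \<le> x $ i \<and>
      x $ i \<le> a $ i + (real (c i) + 1) * (D / k))" for c :: "'p \<Rightarrow> nat" and x
  have ex: "\<exists>c \<in> UNIV \<rightarrow>\<^sub>E {..<k}. cell c x" if x: "x \<in> X" for x
  proof -
    have "\<exists>j<k. a $ i + real j * (D / k) \<le> x $ i \<and> x $ i \<le> a $ i + (real j + 1) * (D / k)" for i
    proof (cases "x $ i < a $ i + D")
      \<comment> \<open>On the upper face rounding down would give the index \<open>k\<close>, or a
        division by zero if \<open>D = 0\<close>. Such coordinates go to the last cell,
        \<open>k - 1\<close>.\<close>
      case False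
      moreover have "x $ i \<le> a $ i + D" using X x by auto
      ultimately have "x $ i = a $ i + D" by simp
      moreover have "a $ i + real (k - 1) * (D / k) \<le> a $ i + D"
        using D k by (simp add: field_simps mult_left_mono)
      ultimately show ?thesis using k
        by (intro exI [of _ "k - 1"]) (auto simp: of_nat_diff)
    next
      case True
      have lo: "a $ i \<le> x $ i" using X x by auto
      with True have D: "D > 0" by simp
      define t where "t = (x $ i - a $ i) / (D / k)"
      have "(x $ i - a $ i) * k < D * k"
        using True k by (intro mult_strict_right_mono) auto
      then have t: "0 \<le> t" "t < k"
        using lo D k by (auto simp: t_def field_simps)
      have "nat \<lfloor>t\<rfloor> < k" "real (nat \<lfloor>t\<rfloor>) \<le> t" "t \<le> real (nat \<lfloor>t\<rfloor>) + 1"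
        using t by linarith+
      moreover have "x $ i = a $ i + t * (D / k)"
        using D k by (simp add: t_def)
      ultimately show ?thesis
        using D k by (intro exI [of _ "nat \<lfloor>t\<rfloor>"]) (auto intro!: mult_right_mono divide_right_mono)
    qed
    then obtain c where "\<forall>i. c i < k \<and> a $ i + real (c i) * (D / k) \<le> x $ i \<and>
        x $ i \<le> a $ i + (real (c i) + 1) * (D / k)" by metis
    then show ?thesis using x by (intro bexI [of _ c]) (auto simp: cell_def)
  qed
  define C where "C = {c \<in> UNIV \<rightarrow>\<^sub>E {..<k}. \<exists>x. cell c x}"
  define S where "S = (\<lambda>c. SOME x. cell c x) ` C"
  have cell_some: "cell c (SOME x. cell c x)" if "c \<in> C" for c
    using that by (auto simp: C_def intro: someI)
  have finC: "finite (UNIV \<rightarrow>\<^sub>E {..<k} :: ('p \<Rightarrow> nat) set)"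
    by (intro finite_PiE) auto
  show thesis
  proof
    show "finite S" using finC by (simp add: S_def C_def)
    show "S \<noteq> {}" using X(2) ex by (force simp: S_def C_def)
    show "S \<subseteq> X" using cell_some by (auto simp: S_def cell_def)
    have "card S \<le> card C" unfolding S_def using finC by (intro card_image_le) (simp add: C_def)
    also have "\<dots> \<le> card (UNIV \<rightarrow>\<^sub>E {..<k} :: ('p \<Rightarrow> nat) set)"
      by (intro card_mono finC) (auto simp: C_def)
    also have "\<dots> = k ^ CARD('p)" by (simp add: card_funcsetE)
    finally show "card S \<le> k ^ CARD('p)" .
    fix x assume x: "x \<in> X"
    obtain c where c: "c \<in> UNIV \<rightarrow>\<^sub>E {..<k}" "cell c x" using ex [OF x] by auto
    then have cC: "c \<in> C" by (auto simp: C_def)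
    define y where "y = (SOME x. cell c x)"
    have y: "cell c y" unfolding y_def by (rule cell_some [OF cC])
    have "norm (x - y) \<le> norm (\<chi> i::'p. D / k)"
    proof (rule norm_le_componentwise_cart)
      fix i
      have "a $ i + real (c i) * (D / k) \<le> x $ i" "x $ i \<le> a $ i + (real (c i) + 1) * (D / k)"
        "a $ i + real (c i) * (D / k) \<le> y $ i" "y $ i \<le> a $ i + (real (c i) + 1) * (D / k)"
        using c(2) y unfolding cell_def by auto
      then have "\<bar>x $ i - y $ i\<bar> \<le> D / k"
        unfolding distrib_right by linarith
      then show "norm ((x - y) $ i) \<le> norm ((\<chi> i::'p. D / k) $ i)" using D by simp
    qed
    also have "\<dots> = D * sqrt CARD('p) / k"
      using D by (simp add: norm_vec_def L2_set_def real_sqrt_mult real_sqrt_divide)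
    finally show "\<exists>y\<in>S. norm (x - y) \<le> D * sqrt CARD('p) / k"
      using cC by (auto simp: S_def y_def)
  qed
qed

text \<open>The tangent of \<open>ln\<close> at \<open>exp 1\<close>; this is where
  \<open>exp 1\<close> in \<open>N_const\<close> comes from.\<close>

lemma ln_le_div_exp_1: "x > 0 \<Longrightarrow> ln x \<le> x / exp 1" for x :: real
proof -
  assume "x > 0"
  then have "ln (x / exp 1) \<le> x / exp 1 - 1" by (intro ln_le_minus_one) auto
  with \<open>x > 0\<close> show ?thesis by (simp add: ln_div)
qed

text \<open>The tangent bound, applied to \<open>x powr (1 - 2 * l)\<close>, trades the logarithm
  for a power of \<open>x\<close>. This produces the denominator of the last summand of
  \<open>N_const\<close>.\<close>

lemma sqrt_ln_div_le:
  fixes x l :: real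
  assumes "x \<ge> 1" "l < 1 / 2"
  shows "sqrt (ln x / x) \<le> 1 / (sqrt ((1 - 2 * l) * exp 1) * x powr l)"
proof -
  have "(1 - 2 * l) * ln x \<le> x powr (1 - 2 * l) / exp 1"
    using ln_le_div_exp_1 [of "x powr (1 - 2 * l)"] assms by (simp add: ln_powr)
  also have "x powr (1 - 2 * l) = x / (x powr l)\<^sup>2"
    using assms by (simp add: powr_diff powr_power mult.commute)
  finally have "ln x / x \<le> 1 / ((1 - 2 * l) * exp 1 * (x powr l)\<^sup>2)"
    using assms by (simp add: field_simps)
  then have "sqrt (ln x / x) \<le> sqrt (1 / ((1 - 2 * l) * exp 1 * (x powr l)\<^sup>2))"
    by (rule real_sqrt_le_mono)
  also have "\<dots> = 1 / (sqrt ((1 - 2 * l) * exp 1) * x powr l)"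
    by (simp add: real_sqrt_divide real_sqrt_mult)
  finally show ?thesis .
qed

text \<open>With about \<open>n powr (1 / (2 * \<gamma>))\<close> cells per axis the Hoelder error
  is of order \<open>1 / sqrt n\<close>, while the size of the net enters only through its
  logarithm. The three summands of \<open>N_const\<close> account for the Hoelder error, for
  \<open>ln 2\<close> and for the logarithm of the net size.\<close>

lemma grid_rate:
  fixes D L \<gamma> M lam :: real and k n p :: nat
  assumes n: "n \<ge> 1" and p: "p \<ge> 1" and \<gamma>: "0 < \<gamma>" "\<gamma> \<le> 1" and lam: "lam < 1 / 2"
    and nonneg: "0 \<le> L" "0 \<le> D" "0 < M"
    and k: "k = nat \<lceil>real n powr (1 / (2 * \<gamma>))\<rceil>" and N: "1 \<le> N" "N \<le> k ^ p"
  shows "sqrt (2 * (M\<^sup>2 / n) * ln (2 * real N)) + 2 * (L * (D * sqrt p / k) powr \<gamma>)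
    \<le> 2 * N_const p D L \<gamma> M lam / n powr lam"
proof -
  define t where "t = real n powr (1 / (2 * \<gamma>))"
  have t1: "t \<ge> 1" using n \<gamma> by (simp add: t_def ge_one_powr_ge_zero)
  have tk: "t \<le> k" "real k \<le> t + 1" using t1 unfolding k t_def [symmetric] by linarith+
  have k1: "k \<ge> 1" using tk t1 by linarith
  have n12: "sqrt (1 / n) \<le> 1 / n powr lam"
  proof -
    have "n powr lam \<le> n powr (1 / 2)" using n lam by (intro powr_mono) auto
    then show ?thesis using n by (simp add: powr_half_sqrt real_sqrt_divide field_simps)
  qed
  \<comment> \<open>Rounding \<open>t\<close> up to \<open>k\<close> costs a factor \<open>4\<close>
    on the logarithm, hence \<open>2\<close> after the square root, which the leading
    \<open>2\<close> on the right-hand side absorbs. For \<open>n = 1\<close> both sides vanish;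
    otherwise \<open>\<gamma> \<le> 1\<close> gives \<open>t \<ge> sqrt 2\<close>, and then
    \<open>t + 1 \<le> t ^ 4\<close>.\<close>
  have lnk: "ln k \<le> 4 * ln t"
  proof (cases "n = 1")
    case True
    then show ?thesis by (simp add: k t_def)
  next
    case False
    then have "2 powr (1 / 2) \<le> real n powr (1 / 2)" using n by (intro powr_mono2) auto
    also have "\<dots> \<le> t" unfolding t_def using n \<gamma> by (intro powr_mono) (auto simp: field_simps)
    finally have "sqrt 2 \<le> t" by (simp add: powr_half_sqrt)
    then have "(sqrt 2)\<^sup>2 \<le> t\<^sup>2" by (intro power_mono) auto
    then have t2: "2 \<le> t\<^sup>2" by simp
    have "t \<le> t\<^sup>2" using t1 by (simp add: power2_eq_square)
    then have "t + 1 \<le> 2 * t\<^sup>2" using t2 by linarith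
    also have "\<dots> \<le> t\<^sup>2 * t\<^sup>2" using t2 by (intro mult_right_mono) auto
    finally have "real k \<le> t ^ 4" using tk by (simp add: power4_eq_xxxx power2_eq_square)
    then have "ln k \<le> ln (t ^ 4)" using k1 t1 by (intro ln_mono) auto
    then show ?thesis using t1 by (simp add: ln_realpow)
  qed
  have lnt: "ln t = ln n / (2 * \<gamma>)" using n by (simp add: t_def ln_powr)
  have "ln (2 * real N) = ln 2 + ln (real N)" using N by (simp add: ln_mult)
  also have "ln (real N) \<le> ln (real k ^ p)"
    using N k1 by (intro ln_mono) (auto simp: of_nat_le_iff [symmetric] simp del: of_nat_le_iff)
  also have "\<dots> = p * ln k" using k1 by (simp add: ln_realpow)
  also have "\<dots> \<le> p * (4 * (ln n / (2 * \<gamma>)))"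
    using lnk unfolding lnt by (intro mult_left_mono) auto
  finally have lnN: "ln (2 * real N) \<le> ln 2 + 2 * (p / \<gamma>) * ln n" using \<gamma> by (simp add: field_simps)
  have "sqrt (2 * (M\<^sup>2 / n) * ln (2 * real N)) \<le>
      sqrt (M\<^sup>2 * (2 * ln 2) * (1 / n) + (2 * M)\<^sup>2 * (p / \<gamma>) * (ln n / n))"
  proof (rule real_sqrt_le_mono)
    have "2 * (M\<^sup>2 / n) * ln (2 * real N) \<le> 2 * (M\<^sup>2 / n) * (ln 2 + 2 * (p / \<gamma>) * ln n)"
      by (intro mult_left_mono lnN) auto
    also have "\<dots> = M\<^sup>2 * (2 * ln 2) * (1 / n) + (2 * M)\<^sup>2 * (p / \<gamma>) * (ln n / n)"
      by (simp add: add_divide_distrib algebra_simps power2_eq_square)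
    finally show "2 * (M\<^sup>2 / n) * ln (2 * real N) \<le> \<dots>" .
  qed
  also have "\<dots> \<le> sqrt (M\<^sup>2 * (2 * ln 2) * (1 / n)) + sqrt ((2 * M)\<^sup>2 * (p / \<gamma>) * (ln n / n))"
    using n \<gamma> by (intro sqrt_add_le_add_sqrt) auto
  also have "sqrt (M\<^sup>2 * (2 * ln 2) * (1 / n)) = M * sqrt (2 * ln 2) * sqrt (1 / n)"
    using nonneg by (simp only: real_sqrt_mult real_sqrt_abs abs_of_pos)
  also have "sqrt ((2 * M)\<^sup>2 * (p / \<gamma>) * (ln n / n)) = 2 * M * sqrt (p / \<gamma>) * sqrt (ln n / n)"
    using nonneg by (simp only: real_sqrt_mult real_sqrt_abs)
  also have "M * sqrt (2 * ln 2) * sqrt (1 / n) \<le> M * sqrt (2 * ln 2) * (1 / n powr lam)"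
    using nonneg n12 by (intro mult_left_mono) auto
  also have "2 * M * sqrt (p / \<gamma>) * sqrt (ln n / n) \<le>
      2 * M * sqrt (p / \<gamma>) * (1 / (sqrt ((1 - 2 * lam) * exp 1) * n powr lam))"
    using nonneg n lam \<gamma> by (intro mult_left_mono sqrt_ln_div_le) auto
  also have "\<dots> = 2 * (M * sqrt p / sqrt (\<gamma> * (1 - 2 * lam) * exp 1)) / n powr lam"
    by (simp add: real_sqrt_mult real_sqrt_divide mult.assoc)
  finally have A: "sqrt (2 * (M\<^sup>2 / n) * ln (2 * real N)) \<le> M * sqrt (2 * ln 2) * (1 / n powr lam) +
      2 * (M * sqrt p / sqrt (\<gamma> * (1 - 2 * lam) * exp 1)) / n powr lam" by simp
  have "(D * sqrt p / k) powr \<gamma> \<le> (D * sqrt p / t) powr \<gamma>"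
    using tk t1 nonneg \<gamma> by (intro powr_mono2 divide_left_mono) auto
  also have "\<dots> = D powr \<gamma> * p powr (\<gamma> / 2) * (1 / t powr \<gamma>)"
    using t1 nonneg by (simp add: powr_divide powr_mult powr_half_sqrt [symmetric] powr_powr)
  also have "t powr \<gamma> = sqrt n"
    using \<gamma> by (simp add: t_def powr_powr powr_half_sqrt)
  also have "1 / sqrt n = sqrt (1 / n)" by (simp add: real_sqrt_divide)
  also have "D powr \<gamma> * p powr (\<gamma> / 2) * sqrt (1 / n) \<le> D powr \<gamma> * p powr (\<gamma> / 2) * (1 / n powr lam)"
    by (intro mult_left_mono n12) auto
  finally have "2 * (L * (D * sqrt p / k) powr \<gamma>) \<le>
      2 * (L * (D powr \<gamma> * p powr (\<gamma> / 2) * (1 / n powr lam)))"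
    using nonneg by (intro mult_left_mono) auto
  moreover have "M * sqrt (2 * ln 2) * (1 / n powr lam) \<le> 2 * (M * sqrt (2 * ln 2)) * (1 / n powr lam)"
    using nonneg by (intro mult_right_mono) auto
  ultimately have "sqrt (2 * (M\<^sup>2 / n) * ln (2 * real N)) + 2 * (L * (D * sqrt p / k) powr \<gamma>) \<le>
      2 * (M * sqrt (2 * ln 2)) * (1 / n powr lam) +
      2 * (M * sqrt p / sqrt (\<gamma> * (1 - 2 * lam) * exp 1)) / n powr lam +
      2 * (L * (D powr \<gamma> * p powr (\<gamma> / 2) * (1 / n powr lam)))"
    using A by linarith
  also have "\<dots> = 2 * N_const p D L \<gamma> M lam / n powr lam"
    by (simp add: N_const_def add_divide_distrib algebra_simps)
  finally show ?thesis .
qed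

subsection \<open>The pessimistic distance of compromise decisions\<close>

lemma pess_dist_le:
  assumes "A \<noteq> {}" and "\<And>a. a \<in> A \<Longrightarrow> \<exists>b\<in>B. norm (a - b) \<le> r"
  shows "pess_dist A B \<le> r"
  unfolding pess_dist_def
proof (rule cSUP_least [OF assms(1)])
  fix a assume "a \<in> A"
  then obtain b where b: "b \<in> B" "norm (a - b) \<le> r" using assms(2) by blast
  have "(INF b\<in>B. norm (a - b)) \<le> norm (a - b)"
    using b(1) by (intro cINF_lower bdd_belowI [of _ 0]) auto
  with b show "(INF b\<in>B. norm (a - b)) \<le> r" by linarith
qed

text \<open>Nonnegativity is what later allows an upper bound on the distance to be squared.
  Boundedness of \<open>A\<close> makes the real supremum an actual upper bound of the
  distances.\<close>

lemma pess_dist_nonneg: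
  assumes "A \<noteq> {}" "B \<noteq> {}" "bounded A"
  shows "0 \<le> pess_dist A B"
proof -
  obtain a b where ab: "a \<in> A" "b \<in> B" using assms by auto
  obtain r where r: "\<And>a. a \<in> A \<Longrightarrow> norm a \<le> r"
    using assms(3) by (auto simp: bounded_iff)
  have "0 \<le> (INF b\<in>B. norm (a - b))"
    using assms(2) by (intro cINF_greatest) auto
  also have "\<dots> \<le> pess_dist A B"
    unfolding pess_dist_def
  proof (rule cSUP_upper [OF ab(1)], rule bdd_aboveI2)
    fix a' assume "a' \<in> A"
    have "(INF b\<in>B. norm (a' - b)) \<le> norm (a' - b)"
      using ab(2) by (intro cINF_lower bdd_belowI [of _ 0]) auto
    also have "\<dots> \<le> r + norm b"
      using r [OF \<open>a' \<in> A\<close>] norm_triangle_ineq4 [of a' b] by linarith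
    finally show "(INF b\<in>B. norm (a' - b)) \<le> r + norm b" .
  qed
  finally show ?thesis .
qed

lemma eps_opt_nonempty:
  assumes "X \<noteq> {}" "bdd_below (g ` X)" "\<epsilon> > 0"
  shows "eps_opt X g \<epsilon> \<noteq> {}"
proof -
  have "(INF y\<in>X. g y) < (INF y\<in>X. g y) + \<epsilon>" using assms by simp
  then obtain x where "x \<in> X" "g x < (INF y\<in>X. g y) + \<epsilon>"
    using cINF_less_iff [OF assms(1,2)] by blast
  then show ?thesis by (auto simp: eps_opt_def)
qed

text \<open>The point is obtained by moving the fraction \<open>u / \<epsilon>\<close> of the way towards a \<open>u\<close>-optimal
  point.\<close>

lemma eps_opt_near:
  assumes conv: "convex_on X f" and bX: "bounded X" and bf: "bdd_below (f ` X)"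
    and x: "x \<in> X" "f x \<le> (INF y\<in>X. f y) + \<epsilon> + u" and "\<epsilon> > 0" "u \<ge> 0"
  shows "\<exists>z\<in>eps_opt X f \<epsilon>. norm (x - z) \<le> u / \<epsilon> * diameter X"
proof -
  have Xne: "X \<noteq> {}" using x by auto
  have D: "norm (y - z) \<le> diameter X" if "y \<in> X" "z \<in> X" for y z
    using diameter_bounded_bound [OF bX that] by (simp add: dist_norm)
  \<comment> \<open>For \<open>u = 0\<close> a \<open>u\<close>-optimal point might not exist, but
    then \<open>x\<close> itself belongs to the set. For \<open>u > \<epsilon>\<close> the fraction
    would exceed \<open>1\<close>, and any \<epsilon>-optimal point is near enough by the diameter
    bound.\<close>
  consider "u = 0" | "0 < u" "u \<le> \<epsilon>" | "u > \<epsilon>" using \<open>u \<ge> 0\<close> by linarith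
  then show ?thesis
  proof cases
    case 1
    with x show ?thesis by (intro bexI [of _ x]) (auto simp: eps_opt_def)
  next
    case 2
    obtain y where y: "y \<in> X" "f y \<le> (INF y\<in>X. f y) + u"
      using eps_opt_nonempty [OF Xne bf 2(1)] by (auto simp: eps_opt_def)
    define t where "t = u / \<epsilon>"
    have t: "0 \<le> t" "t \<le> 1" and u: "u = t * \<epsilon>"
      using 2 \<open>\<epsilon> > 0\<close> by (auto simp: t_def)
    define z where "z = (1 - t) *\<^sub>R x + t *\<^sub>R y"
    have "convex X" using conv by (auto simp: convex_on_def)
    then have zX: "z \<in> X"
      unfolding z_def using x y t by (intro convexD) auto
    have "f z \<le> (1 - t) * f x + t * f y"
      unfolding z_def using conv t x y by (intro convex_onD) auto
    also have "\<dots> \<le> (1 - t) * ((INF y\<in>X. f y) + \<epsilon> + u) + t * ((INF y\<in>X. f y) + u)"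
      using t x y by (intro add_mono mult_left_mono) auto
    also have "\<dots> = (INF y\<in>X. f y) + \<epsilon>"
      by (simp add: u algebra_simps)
    finally have "z \<in> eps_opt X f \<epsilon>" using zX by (simp add: eps_opt_def)
    moreover have "norm (x - z) \<le> u / \<epsilon> * diameter X"
    proof -
      have "x - z = t *\<^sub>R (x - y)" by (simp add: z_def algebra_simps)
      then show ?thesis
        using t D [OF x(1) y(1)] by (simp add: t_def [symmetric] mult_left_mono)
    qed
    ultimately show ?thesis by blast
  next
    case 3
    obtain z where z: "z \<in> eps_opt X f \<epsilon>" using eps_opt_nonempty [OF Xne bf \<open>\<epsilon> > 0\<close>] by auto
    have "norm (x - z) \<le> 1 * diameter X" using D x z by (auto simp: eps_opt_def)
    also have "\<dots> \<le> u / \<epsilon> * diameter X"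
      using 3 \<open>\<epsilon> > 0\<close> by (intro mult_right_mono diameter_ge_0 bX) auto
    finally show ?thesis using z by blast
  qed
qed

text \<open>Turns the quadratic estimate of the proximal term into an affine one in \<open>r\<close>
  whose slope \<open>D\<close> is free of \<open>q\<close>, hence of \<rho>. If \<open>d\<close>
  exceeded the bound, then \<open>q \<le> D\<close>, and the excess \<open>q\<^sup>2 * r / 2\<close>
  would be swallowed by the cross term of \<open>(r * D + q)\<^sup>2\<close>.\<close>

lemma le_add_of_square_le:
  fixes d q r D :: real
  assumes "d \<le> D" "0 \<le> q" "0 \<le> r" "0 \<le> D" "d\<^sup>2 \<le> q\<^sup>2 * (1 + r / 2)"
  shows "d \<le> r * D + q"
proof (rule ccontr)
  assume "\<not> ?thesis"
  then have d: "r * D + q < d" by simp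
  moreover have "0 \<le> r * D" using assms by simp
  ultimately have "q \<le> D" using assms by linarith
  have "q * (r * q) \<le> q * (r * D)"
    using assms \<open>q \<le> D\<close> by (intro mult_left_mono) auto
  moreover have "0 \<le> q * (r * D)" using assms by simp
  ultimately have "q\<^sup>2 * (1 + r / 2) \<le> q\<^sup>2 + 2 * (q * (r * D))"
    by (simp add: power2_eq_square algebra_simps)
  also have "\<dots> \<le> (r * D + q)\<^sup>2"
    by (simp add: power2_sum)
  also have "\<dots> < d\<^sup>2"
    using d assms by (intro power_strict_mono) auto
  finally show False using assms by simp
qed

text \<open>The deterministic core. Here \<open>g i\<close> stands for a sample average,
  \<open>h i\<close> for its outer approximation with minimiser \<open>z i\<close>, and
  \<open>c i\<close> for the augmented function, which enters through the sandwich
  \<open>h i \<le> c i \<le> g i\<close>.\<close>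

lemma compromise_pess_dist:
  fixes X :: "(real^'p) set" and z :: "nat \<Rightarrow> real^'p"
  assumes conv: "convex_on X f" and bX: "bounded X" and bf: "bdd_below (f ` X)"
    and m: "m \<ge> 1" and eps: "0 < \<epsilon>" "\<epsilon> \<le> \<epsilon>\<^sub>1" and "0 < \<rho>"
    and z: "\<And>i. i \<in> {1..m} \<Longrightarrow> z i \<in> X"
    and dev: "\<And>i x. i \<in> {1..m} \<Longrightarrow> x \<in> X \<Longrightarrow> \<bar>g i x - f x\<bar> \<le> \<delta> i"
    and hmin: "\<And>i x. i \<in> {1..m} \<Longrightarrow> x \<in> X \<Longrightarrow> h i (z i) \<le> h i x"
    and hc: "\<And>i x. i \<in> {1..m} \<Longrightarrow> x \<in> X \<Longrightarrow> h i x \<le> c i x"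
    and cg: "\<And>i x. i \<in> {1..m} \<Longrightarrow> x \<in> X \<Longrightarrow> c i x \<le> g i x"
    and gap: "\<And>i. i \<in> {1..m} \<Longrightarrow> g i (z i) - h i (z i) \<le> \<epsilon>\<^sub>1"
    and G: "\<And>x. G x = (\<Sum>i=1..m. c i x) / m + \<rho> / 2 * (norm (x - (1 / m) *\<^sub>R (\<Sum>j=1..m. z j)))\<^sup>2"
  shows "0 \<le> pess_dist (eps_opt X G \<epsilon>) (eps_opt X f \<epsilon>)"
    and "pess_dist (eps_opt X G \<epsilon>) (eps_opt X f \<epsilon>) \<le>
      (4 * ((\<Sum>i=1..m. \<delta> i) / m) + 2 * (\<epsilon>\<^sub>1 - \<epsilon>)) * diameter X / \<epsilon> + 2 * sqrt (\<epsilon> / \<rho>)"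
proof -
  define avg where "avg a = (\<Sum>i=1..m. a i) / real m" for a :: "nat \<Rightarrow> real"
  have avg_mono: "avg a \<le> avg b" if "\<And>i. i \<in> {1..m} \<Longrightarrow> a i \<le> b i" for a b
    unfolding avg_def by (intro divide_right_mono sum_mono that) auto
  have avg_add: "avg (\<lambda>i. a i + b i) = avg a + avg b" for a b
    by (simp add: avg_def sum.distrib add_divide_distrib)
  have avg_const: "avg (\<lambda>_. a) = a" for a
    using m by (simp add: avg_def)
  define xb where "xb = (\<Sum>j=1..m. (1 / real m) *\<^sub>R z j)"
  have "convex X" using conv by (auto simp: convex_on_def)
  then have xbX: "xb \<in> X"
    unfolding xb_def using m z by (intro convex_sum) auto
  then have Xne: "X \<noteq> {}" by auto
  have G: "G x = avg (\<lambda>i. c i x) + \<rho> / 2 * (norm (x - xb))\<^sup>2" for x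
    by (simp add: G avg_def xb_def scaleR_right.sum)
  define a where "a = avg \<delta>"
  have "0 \<le> \<delta> i" if "i \<in> {1..m}" for i using dev [OF that xbX] by linarith
  then have a0: "0 \<le> a"
    unfolding a_def avg_def by (intro divide_nonneg_nonneg sum_nonneg) auto
  have "f xb \<le> (\<Sum>j=1..m. (1 / real m) * f (z j))"
    unfolding xb_def using m z conv by (intro convex_on_sum) auto
  also have "\<dots> = avg (\<lambda>j. f (z j))"
    unfolding avg_def by (simp add: sum_divide_distrib)
  also have "\<dots> \<le> avg (\<lambda>j. g j (z j) + \<delta> j)"
    using dev z by (intro avg_mono) (force simp: abs_le_iff)
  finally have f_xb: "f xb \<le> avg (\<lambda>j. g j (z j)) + a" by (simp add: avg_add a_def)
  have g_h: "avg (\<lambda>j. g j (z j)) \<le> avg (\<lambda>j. h j (z j)) + \<epsilon>\<^sub>1"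
  proof -
    have "avg (\<lambda>j. g j (z j)) \<le> avg (\<lambda>j. h j (z j) + \<epsilon>\<^sub>1)"
      using gap by (intro avg_mono) (force simp: diff_le_eq)
    then show ?thesis by (simp add: avg_add avg_const)
  qed
  \<comment> \<open>The amount by which \<open>f xb\<close> may exceed the threshold of
    \<epsilon>-optimality: one \<open>a\<close> for passing from \<open>f\<close> to the samples at
    the points \<open>z j\<close>, one for passing back at a competitor \<open>y\<close>. It is
    nonnegative because \<open>\<epsilon> \<le> \<epsilon>\<^sub>1\<close>.\<close>
  define u where "u = 2 * a + \<epsilon>\<^sub>1 - \<epsilon>"
  have u0: "u \<ge> 0" using a0 eps by (simp add: u_def)
  have "f xb - (2 * a + \<epsilon>\<^sub>1) \<le> (INF y\<in>X. f y)"
  proof (rule cINF_greatest [OF Xne])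
    fix y assume y: "y \<in> X"
    have "avg (\<lambda>j. h j (z j)) \<le> avg (\<lambda>j. f y + \<delta> j)"
    proof (rule avg_mono)
      fix i assume i: "i \<in> {1..m}"
      show "h i (z i) \<le> f y + \<delta> i"
        using hmin [OF i y] hc [OF i y] cg [OF i y] dev [OF i y] by linarith
    qed
    also have "\<dots> = f y + a" by (simp add: avg_add avg_const a_def)
    finally show "f xb - (2 * a + \<epsilon>\<^sub>1) \<le> f y" using f_xb g_h by linarith
  qed
  then have "f xb \<le> (INF y\<in>X. f y) + \<epsilon> + u" by (simp add: u_def)
  from eps_opt_near [OF conv bX bf xbX this eps(1) u0]
  obtain w where w: "w \<in> eps_opt X f \<epsilon>" "norm (xb - w) \<le> u / \<epsilon> * diameter X" by blast
  have c_lower: "avg (\<lambda>i. h i (z i)) \<le> avg (\<lambda>i. c i x)" if "x \<in> X" for x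
    using hmin hc that by (intro avg_mono) (blast intro: order_trans)
  have bG: "bdd_below (G ` X)"
  proof (rule bdd_belowI2)
    fix x assume "x \<in> X"
    from c_lower [OF this] \<open>0 < \<rho>\<close> show "avg (\<lambda>i. h i (z i)) \<le> G x"
      by (simp add: G add_increasing2)
  qed
  note neG = eps_opt_nonempty [OF Xne bG eps(1)]
  show "0 \<le> pess_dist (eps_opt X G \<epsilon>) (eps_opt X f \<epsilon>)"
    using neG w(1) bX by (intro pess_dist_nonneg) (auto simp: eps_opt_def elim: bounded_subset)
  \<comment> \<open>The single point \<open>w\<close> near \<open>xb\<close> serves every compromise
    decision, since each of these lies close to \<open>xb\<close>.\<close>
  show "pess_dist (eps_opt X G \<epsilon>) (eps_opt X f \<epsilon>) \<le>
      (4 * ((\<Sum>i=1..m. \<delta> i) / m) + 2 * (\<epsilon>\<^sub>1 - \<epsilon>)) * diameter X / \<epsilon> + 2 * sqrt (\<epsilon> / \<rho>)"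
  proof (rule pess_dist_le [OF neG], rule bexI [OF _ w(1)])
    fix x assume "x \<in> eps_opt X G \<epsilon>"
    then have x: "x \<in> X" "G x \<le> (INF y\<in>X. G y) + \<epsilon>" by (auto simp: eps_opt_def)
    \<comment> \<open>The comparison point is \<open>xb\<close>, where the proximal term
      vanishes.\<close>
    note x(2)
    also have "(INF y\<in>X. G y) \<le> G xb" using xbX bG by (intro cINF_lower)
    finally have "G x \<le> avg (\<lambda>i. c i xb) + \<epsilon>" by (simp add: G)
    moreover have "avg (\<lambda>i. c i xb) \<le> avg (\<lambda>i. f xb + \<delta> i)"
    proof (rule avg_mono)
      fix i assume i: "i \<in> {1..m}"
      show "c i xb \<le> f xb + \<delta> i" using cg [OF i xbX] dev [OF i xbX] by linarith
    qed
    ultimately have "\<rho> / 2 * (norm (x - xb))\<^sup>2 \<le> u + 2 * \<epsilon>"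
      using f_xb g_h c_lower [OF x(1)] unfolding G avg_add avg_const a_def [symmetric] u_def by linarith
    then have "(norm (x - xb))\<^sup>2 \<le> (u + 2 * \<epsilon>) * 2 / \<rho>"
      using \<open>0 < \<rho>\<close> by (simp add: field_simps)
    \<comment> \<open>The form required by \<open>le_add_of_square_le\<close> with
      \<open>q = 2 * sqrt (\<epsilon> / \<rho>)\<close> and \<open>r = u / \<epsilon>\<close>. The
      resulting term \<open>u / \<epsilon> * diameter X\<close> adds to the equal bound on the
      distance from \<open>xb\<close> to \<open>w\<close>, which doubles it.\<close>
    also have "\<dots> = (2 * sqrt (\<epsilon> / \<rho>))\<^sup>2 * (1 + u / \<epsilon> / 2)"
      using \<open>0 < \<rho>\<close> eps by (simp add: power_mult_distrib field_simps)
    finally have "(norm (x - xb))\<^sup>2 \<le> \<dots>" .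
    then have "norm (x - xb) \<le> u / \<epsilon> * diameter X + 2 * sqrt (\<epsilon> / \<rho>)"
      using diameter_bounded_bound [OF bX x(1) xbX] \<open>0 < \<rho>\<close> eps u0 diameter_ge_0 [OF bX]
      by (intro le_add_of_square_le) (auto simp: dist_norm)
    from norm_triangle_mono [OF this w(2)]
    have "norm (x - w) \<le> 2 * (u / \<epsilon> * diameter X) + 2 * sqrt (\<epsilon> / \<rho>)" by simp
    also have "2 * (u / \<epsilon> * diameter X) =
        (4 * ((\<Sum>i=1..m. \<delta> i) / m) + 2 * (\<epsilon>\<^sub>1 - \<epsilon>)) * diameter X / \<epsilon>"
      by (simp add: u_def a_def avg_def field_simps)
    finally show "norm (x - w) \<le>
      (4 * ((\<Sum>i=1..m. \<delta> i) / m) + 2 * (\<epsilon>\<^sub>1 - \<epsilon>)) * diameter X / \<epsilon> + 2 * sqrt (\<epsilon> / \<rho>)" .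
  qed
qed

subsection \<open>Uniform deviation of the sample averages\<close>

lemma abs_mean_le:
  fixes a :: "'i \<Rightarrow> real"
  assumes "finite J" "0 \<le> B" "\<And>k. k \<in> J \<Longrightarrow> \<bar>a k\<bar> \<le> B"
  shows "\<bar>(\<Sum>k\<in>J. a k) / real (card J)\<bar> \<le> B"
proof (cases "J = {}")
  case False
  have "\<bar>\<Sum>k\<in>J. a k\<bar> \<le> (\<Sum>k\<in>J. B)"
    using assms(3) by (intro order_trans [OF sum_abs] sum_mono)
  then show ?thesis
    using False assms(1) by (simp add: abs_divide divide_le_eq card_gt_0_iff mult.commute)
qed (use assms in auto)

context stochastic_program
begin

abbreviation "\<Xi>M \<equiv> restrict_space borel \<Xi>"
abbreviation "f \<equiv> true_obj P \<xi> F"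

lemma F_abs_le: "x \<in> X \<Longrightarrow> y \<in> \<Xi> \<Longrightarrow> \<bar>F x y\<bar> \<le> M\<^sub>F"
  using cSUP_upper [OF _ F_bounded(1), of "(x, y)"] F_bounded(2) by auto

lemma xi_in: "\<omega> \<in> space P \<Longrightarrow> \<xi> \<omega> \<in> \<Xi>"
  using xi_range by auto

lemma integrable_F_xi: "x \<in> X \<Longrightarrow> integrable P (\<lambda>\<omega>. F x (\<xi> \<omega>))"
  by (rule integrable_const_bound [OF AE_I2, where B = M\<^sub>F])
    (auto intro: F_abs_le xi_in intro!: measurable_compose [OF _ F_measurable]
      measurable_restrict_space2 xi_measurable xi_range)

lemma true_obj_abs_le: "x \<in> X \<Longrightarrow> \<bar>f x\<bar> \<le> M\<^sub>F"
proof -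
  assume x: "x \<in> X"
  have "\<bar>f x\<bar> \<le> (\<integral>\<omega>. \<bar>F x (\<xi> \<omega>)\<bar> \<partial>P)"
    unfolding true_obj_def by (rule integral_abs_bound)
  also have "\<dots> \<le> (\<integral>\<omega>. M\<^sub>F \<partial>P)"
    using x by (intro integral_mono integrable_abs integrable_F_xi) (auto intro: F_abs_le xi_in)
  finally show ?thesis by (simp add: prob_space)
qed

lemma true_obj_bdd_below: "bdd_below (f ` X)"
  using true_obj_abs_le by (intro bdd_belowI2 [of _ "- M\<^sub>F"]) (force simp: abs_le_iff)

lemma true_obj_convex: "convex_on X f"
  unfolding convex_on_def
proof (intro conjI ballI allI impI)
  fix x y :: "real^'p" and u v :: real
  assume *: "x \<in> X" "y \<in> X" "0 \<le> u" "0 \<le> v" "u + v = 1"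
  then have uv: "u *\<^sub>R x + v *\<^sub>R y \<in> X" using X_convex by (intro convexD) auto
  have "f (u *\<^sub>R x + v *\<^sub>R y) \<le> (\<integral>\<omega>. u * F x (\<xi> \<omega>) + v * F y (\<xi> \<omega>) \<partial>P)"
    unfolding true_obj_def
    using * uv F_convex [OF xi_in]
    by (intro integral_mono integrable_F_xi Bochner_Integration.integrable_add integrable_mult_right)
      (auto simp: convex_on_def)
  also have "\<dots> = u * f x + v * f y"
    using * by (simp add: true_obj_def integrable_F_xi)
  finally show "f (u *\<^sub>R x + v *\<^sub>R y) \<le> u * f x + v * f y" .
qed (rule X_convex)

lemma true_obj_hoelder:
  assumes "x \<in> X" "y \<in> X"
  shows "\<bar>f x - f y\<bar> \<le> L\<^sub>F * norm (x - y) powr \<gamma>"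
proof -
  have "f x - f y = (\<integral>\<omega>. F x (\<xi> \<omega>) - F y (\<xi> \<omega>) \<partial>P)"
    using assms by (simp add: true_obj_def integrable_F_xi)
  also have "\<bar>\<dots>\<bar> \<le> (\<integral>\<omega>. \<bar>F x (\<xi> \<omega>) - F y (\<xi> \<omega>)\<bar> \<partial>P)"
    by (rule integral_abs_bound)
  also have "\<dots> \<le> (\<integral>\<omega>. L\<^sub>F * norm (x - y) powr \<gamma> \<partial>P)"
    using assms by (intro integral_mono integrable_abs Bochner_Integration.integrable_diff
        integrable_F_xi) (auto intro: F_hoelder xi_in)
  finally show ?thesis by (simp add: prob_space)
qed

text \<open>Two distinct points force the sign through the Hoelder bound. On a singleton
  \<open>X\<close> that bound reads \<open>0 \<le> 0\<close>, so \<open>L\<^sub>F\<close> may be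
  negative there; hence the condition on the diameter.\<close>

lemma L_F_nonneg:
  assumes "diameter X \<noteq> 0"
  shows "0 \<le> L\<^sub>F"
proof (rule ccontr)
  assume "\<not> 0 \<le> L\<^sub>F"
  have "x = y" if "x \<in> X" "y \<in> X" for x y
  proof (rule ccontr)
    assume "x \<noteq> y"
    then have "L\<^sub>F * norm (x - y) powr \<gamma> < 0"
      using \<open>\<not> 0 \<le> L\<^sub>F\<close> by (intro mult_neg_pos) auto
    moreover have "0 \<le> L\<^sub>F * norm (x - y) powr \<gamma>"
      using true_obj_hoelder [OF that] by linarith
    ultimately show False by simp
  qed
  then obtain x where "X = {x}" using X_nonempty by blast
  with assms show False by simp
qed

lemma D_nonneg: "0 \<le> D"
  using X_cube cube_edge_nonneg X_nonempty by blast

lemma N_const_nonneg: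
  assumes "0 \<le> L" "lam < 1 / 2"
  shows "0 \<le> N_const p D L \<gamma> M\<^sub>F lam"
  unfolding N_const_def using assms M_F_pos gamma
  by (intro add_nonneg_nonneg mult_nonneg_nonneg divide_nonneg_nonneg) auto

text \<open>Since \<open>\<Xi>\<close> need not be a Borel set, the sample is viewed in the trace sigma-algebra, where
  the integrand is measurable.\<close>

lemma iid_copies_restrict:
  assumes "iid_copies P \<xi> \<Xi> N \<xi>s"
  shows "indep_vars (\<lambda>_. \<Xi>M) \<xi>s {1..N}"
    and "k \<in> {1..N} \<Longrightarrow> distr P \<Xi>M (\<xi>s k) = distr P \<Xi>M \<xi>"
proof -
  have indep: "indep_vars (\<lambda>_. borel) \<xi>s {1..N}"
    and distr: "\<And>k. k \<in> {1..N} \<Longrightarrow> distr P borel (\<xi>s k) = distr P borel \<xi>"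
    and range: "\<And>k. k \<in> {1..N} \<Longrightarrow> \<xi>s k \<in> space P \<rightarrow> \<Xi>"
    using assms by (auto simp: iid_copies_def)
  have rv: "random_variable borel (\<xi>s k)" if "k \<in> {1..N}" for k
    using indep that by (auto simp: indep_vars_def)
  have rvX: "random_variable \<Xi>M (\<xi>s k)" if "k \<in> {1..N}" for k
    using rv range that by (intro measurable_restrict_space2) auto
  \<comment> \<open>A map into \<Xi> does not distinguish a Borel set from its trace, so both
    sigma-algebras generate the same events.\<close>
  have vimage: "g -` (\<Xi> \<inter> A) \<inter> space P = g -` A \<inter> space P" if "g \<in> space P \<rightarrow> \<Xi>" for g A
    using that by auto
  show "indep_vars (\<lambda>_. \<Xi>M) \<xi>s {1..N}"
    unfolding indep_vars_def2
  proof (intro conjI ballI rvX)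
    have "indep_sets (\<lambda>k. {\<xi>s k -` A \<inter> space P |A. A \<in> sets borel}) {1..N}"
      using indep by (auto simp: indep_vars_def2)
    then show "indep_sets (\<lambda>k. {\<xi>s k -` A \<inter> space P |A. A \<in> sets \<Xi>M}) {1..N}"
    proof (rule indep_sets_mono_sets, safe)
      fix k A assume "k \<in> {1..N}" "A \<in> sets \<Xi>M"
      then show "\<exists>B. \<xi>s k -` A \<inter> space P = \<xi>s k -` B \<inter> space P \<and> B \<in> sets borel"
        unfolding sets_restrict_space using vimage [OF range] by blast
    qed
  qed
  assume k: "k \<in> {1..N}"
  have xiX: "random_variable \<Xi>M \<xi>"
    by (intro measurable_restrict_space2 xi_measurable xi_range)
  show "distr P \<Xi>M (\<xi>s k) = distr P \<Xi>M \<xi>"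
  proof (rule measure_eqI)
    fix A assume A: "A \<in> sets (distr P \<Xi>M (\<xi>s k))"
    then obtain B where B: "B \<in> sets borel" "A = \<Xi> \<inter> B" by (auto simp: sets_restrict_space)
    have "emeasure (distr P \<Xi>M (\<xi>s k)) A = emeasure P (\<xi>s k -` B \<inter> space P)"
      using A rvX [OF k] by (simp add: emeasure_distr B vimage [OF range [OF k]] del: vimage_Int)
    also have "\<dots> = emeasure (distr P borel (\<xi>s k)) B"
      using rv [OF k] B by (simp add: emeasure_distr)
    also have "\<dots> = emeasure P (\<xi> -` B \<inter> space P)"
      using B xi_measurable by (simp add: distr [OF k] emeasure_distr)
    also have "\<dots> = emeasure (distr P \<Xi>M \<xi>) A"
      using A xiX by (simp add: emeasure_distr B vimage [OF xi_range] del: vimage_Int)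
    finally show "emeasure (distr P \<Xi>M (\<xi>s k)) A = emeasure (distr P \<Xi>M \<xi>) A" .
  qed simp
qed

text \<open>For \<open>i \<le> m\<close> the block of replication \<open>i\<close> stays inside
  \<open>{1..m * n}\<close>, so neither extensional restriction is ever evaluated outside its
  domain.\<close>

lemma saa_whole_sample:
  assumes "i \<in> {1..m}"
  shows "saa F n (replication n (whole_sample (m * n) \<xi>s \<omega>) i) x =
    (\<Sum>k\<in>{(i - 1) * n + 1..(i - 1) * n + n}. F x (\<xi>s k \<omega>)) / real n"
proof -
  have le: "(i - 1) * n + j \<le> m * n" if "j \<le> n" for j
  proof -
    have "(i - 1) * n + j \<le> (i - 1) * n + n" using that by simp
    also have "\<dots> = i * n" using assms by (cases i) auto
    also have "\<dots> \<le> m * n" using assms by simp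
    finally show ?thesis .
  qed
  have "(\<Sum>k\<in>{(i - 1) * n + 1..(i - 1) * n + n}. F x (\<xi>s k \<omega>)) =
      (\<Sum>j\<in>{1..n}. F x (\<xi>s ((i - 1) * n + j) \<omega>))"
    using sum.shift_bounds_cl_nat_ivl [of "\<lambda>k. F x (\<xi>s k \<omega>)" 1 "(i - 1) * n" n]
    by (simp add: add.commute)
  also have "\<dots> = (\<Sum>j\<in>{1..n}. F x (replication n (whole_sample (m * n) \<xi>s \<omega>) i j))"
    using le by (intro sum.cong) (auto simp: replication_def whole_sample_def)
  finally show ?thesis by (simp add: saa_def)
qed

text \<open>The maximum over a finite net replaces the supremum over \<open>X\<close>, whose measurability is then not
  an issue; truncation at \<open>2 * M\<^sub>F\<close> keeps the trivial bound in spite of the discretisation error.\<close>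

lemma uniform_deviation:
  assumes iid: "iid_copies P \<xi> \<Xi> (m * n) \<xi>s" and n: "1 \<le> n"
    and L: "0 \<le> L\<^sub>F" and lam: "lam < 1 / 2"
  obtains \<delta> :: "nat \<Rightarrow> 'w \<Rightarrow> real" where
    "indep_vars (\<lambda>_. borel) \<delta> {1..m}"
    "\<And>i \<omega>. i \<in> {1..m} \<Longrightarrow> \<omega> \<in> space P \<Longrightarrow> 0 \<le> \<delta> i \<omega> \<and> \<delta> i \<omega> \<le> 2 * M\<^sub>F"
    "\<And>i. i \<in> {1..m} \<Longrightarrow> expectation (\<delta> i) \<le> 2 * N_const CARD('p) D L\<^sub>F \<gamma> M\<^sub>F lam / n powr lam"
    "\<And>i \<omega> x. i \<in> {1..m} \<Longrightarrow> \<omega> \<in> space P \<Longrightarrow> x \<in> X \<Longrightarrow>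
      \<bar>saa F n (replication n (whole_sample (m * n) \<xi>s \<omega>) i) x - f x\<bar> \<le> \<delta> i \<omega>"
proof -
  define k where "k = nat \<lceil>real n powr (1 / (2 * \<gamma>))\<rceil>"
  have "real n powr (1 / (2 * \<gamma>)) \<ge> 1" using n gamma by (simp add: ge_one_powr_ge_zero)
  then have k: "k \<ge> 1" unfolding k_def by linarith
  obtain a where a: "X \<subseteq> {x. \<forall>i. a $ i \<le> x $ i \<and> x $ i \<le> a $ i + D}" using X_cube by blast
  obtain S where S: "finite S" "S \<noteq> {}" "S \<subseteq> X" "card S \<le> k ^ CARD('p)"
    and cover: "\<And>x. x \<in> X \<Longrightarrow> \<exists>y\<in>S. norm (x - y) \<le> D * sqrt CARD('p) / k"
    using cube_cover [OF a X_nonempty k] by blast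
  define r where "r = L\<^sub>F * (D * sqrt CARD('p) / k) powr \<gamma>"
  have r0: "0 \<le> r" using L by (simp add: r_def)
  define J where "J i = {(i - 1) * n + 1..(i - 1) * n + n}" for i
  have cardJ: "card (J i) = n" and finJ: "finite (J i)" and neJ: "J i \<noteq> {}" for i
    using n by (auto simp: J_def)
  have J_le: "J i \<subseteq> {1..m * n}" if "i \<in> {1..m}" for i
  proof -
    have "(i - 1) * n + n = i * n" using that by (cases i) auto
    also have "\<dots> \<le> m * n" using that by simp
    finally show ?thesis by (auto simp: J_def)
  qed
  have J_disj: "disjoint_family_on J {1..m}"
  proof -
    have less: "J i \<inter> J j = {}" if "1 \<le> i" "i < j" for i j
    proof -
      have "(i - 1) * n + n = i * n" using that by (cases i) auto
      also have "\<dots> \<le> (j - 1) * n" using that by (intro mult_right_mono) auto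
      finally show ?thesis by (auto simp: J_def)
    qed
    then show ?thesis
      unfolding disjoint_family_on_def using linorder_neqE_nat by (metis Int_commute atLeastAtMost_iff)
  qed
  note indep = iid_copies_restrict(1) [OF iid] and distr = iid_copies_restrict(2) [OF iid]
  have range: "\<xi>s j \<omega> \<in> \<Xi>" if "j \<in> {1..m * n}" "\<omega> \<in> space P" for j \<omega>
    using iid that by (auto simp: iid_copies_def)
  define W where "W y i \<omega> = (\<Sum>j\<in>J i. F y (\<xi>s j \<omega>)) / real n - f y" for y i \<omega>
  have W_saa: "saa F n (replication n (whole_sample (m * n) \<xi>s \<omega>) i) y - f y = W y i \<omega>"
    if "i \<in> {1..m}" for i y \<omega>
    using saa_whole_sample [OF that] by (simp add: W_def J_def)
  \<comment> \<open>Moving from \<open>x\<close> to a net point changes the sample average and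
    \<open>f\<close> by at most \<open>r\<close> each, hence \<open>2 * r\<close>.\<close>
  define \<delta> where "\<delta> i \<omega> = min (2 * M\<^sub>F) (Max ((\<lambda>y. \<bar>W y i \<omega>\<bar>) ` S) + 2 * r)" for i \<omega>
  have W_bound: "\<bar>W y i \<omega>\<bar> \<le> 2 * M\<^sub>F" if "i \<in> {1..m}" "\<omega> \<in> space P" "y \<in> X" for y i \<omega>
  proof -
    have "\<bar>(\<Sum>j\<in>J i. F y (\<xi>s j \<omega>)) / real (card (J i))\<bar> \<le> M\<^sub>F"
      using that subsetD [OF J_le [OF that(1)]] M_F_pos
      by (intro abs_mean_le finJ F_abs_le range) auto
    then show ?thesis using true_obj_abs_le [OF that(3)] unfolding W_def cardJ by linarith
  qed
  have Max_nonneg: "0 \<le> Max ((\<lambda>y. \<bar>W y i \<omega>\<bar>) ` S)" for i \<omega>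
  proof -
    obtain y where "y \<in> S" using S by auto
    then have "\<bar>W y i \<omega>\<bar> \<le> Max ((\<lambda>y. \<bar>W y i \<omega>\<bar>) ` S)" using S by (intro Max_ge) auto
    then show ?thesis by linarith
  qed
  have dev: "\<bar>W x i \<omega>\<bar> \<le> \<delta> i \<omega>" if i: "i \<in> {1..m}" and \<omega>: "\<omega> \<in> space P" and x: "x \<in> X" for i x \<omega>
  proof -
    obtain y where y: "y \<in> S" "norm (x - y) \<le> D * sqrt CARD('p) / k" using cover x by blast
    then have yX: "y \<in> X" using S by auto
    have le_r: "L\<^sub>F * norm (x - y) powr \<gamma> \<le> r"
      unfolding r_def using L gamma y by (intro mult_left_mono powr_mono2) auto
    have "(\<Sum>j\<in>J i. F x (\<xi>s j \<omega>)) / real n - (\<Sum>j\<in>J i. F y (\<xi>s j \<omega>)) / real n =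
        (\<Sum>j\<in>J i. F x (\<xi>s j \<omega>) - F y (\<xi>s j \<omega>)) / real n"
      by (simp add: sum_subtractf diff_divide_distrib)
    also have "\<bar>\<dots>\<bar> \<le> (\<Sum>j\<in>J i. r) / real n"
      unfolding abs_divide abs_of_nat
    proof (intro divide_right_mono order_trans [OF sum_abs] sum_mono)
      fix j assume "j \<in> J i"
      then have "\<xi>s j \<omega> \<in> \<Xi>" using J_le [OF i] \<omega> by (intro range) auto
      from F_hoelder [OF x yX this] le_r show "\<bar>F x (\<xi>s j \<omega>) - F y (\<xi>s j \<omega>)\<bar> \<le> r" by linarith
    qed auto
    also have "\<dots> = r" using n by (simp add: cardJ)
    finally have "\<bar>W x i \<omega>\<bar> \<le> \<bar>W y i \<omega>\<bar> + 2 * r"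
      using true_obj_hoelder [OF x yX] le_r unfolding W_def by linarith
    also have "\<bar>W y i \<omega>\<bar> \<le> Max ((\<lambda>y. \<bar>W y i \<omega>\<bar>) ` S)"
      using S y by (intro Max_ge) auto
    finally show ?thesis using W_bound [OF i \<omega> x] by (simp add: \<delta>_def)
  qed
  have indep_J: "indep_vars (\<lambda>_. \<Xi>M) \<xi>s (J i)" if "i \<in> {1..m}" for i
    by (rule indep_vars_subset [OF indep J_le [OF that]])
  have rv: "random_variable \<Xi>M (\<xi>s j)" if "j \<in> {1..m * n}" for j
    using indep that by (auto simp: indep_vars_def)
  have rvF: "random_variable borel (\<lambda>\<omega>. F y (\<xi>s j \<omega>))" if "y \<in> X" "j \<in> {1..m * n}" for y j
    using that by (intro measurable_compose [OF rv F_measurable])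
  have rvW: "random_variable borel (W y i)" if "y \<in> X" "i \<in> {1..m}" for y i
    unfolding W_def using that subsetD [OF J_le]
    by (intro borel_measurable_diff borel_measurable_divide borel_measurable_sum rvF) auto
  have meanF: "expectation (\<lambda>\<omega>. F y (\<xi>s j \<omega>)) = f y" if y: "y \<in> X" and j: "j \<in> {1..m * n}" for y j
  proof -
    have "expectation (\<lambda>\<omega>. F y (\<xi>s j \<omega>)) = integral\<^sup>L (distr P \<Xi>M (\<xi>s j)) (F y)"
      using rv j F_measurable y by (intro integral_distr [symmetric])
    also have "\<dots> = integral\<^sup>L (distr P \<Xi>M \<xi>) (F y)" using distr [OF j] by simp
    also have "\<dots> = f y"
      unfolding true_obj_def using F_measurable y
      by (intro integral_distr measurable_restrict_space2 xi_measurable xi_range)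
    finally show ?thesis .
  qed
  show thesis
  proof (rule that)
    show "\<bar>saa F n (replication n (whole_sample (m * n) \<xi>s \<omega>) i) x - f x\<bar> \<le> \<delta> i \<omega>"
      if "i \<in> {1..m}" "\<omega> \<in> space P" "x \<in> X" for i \<omega> x
      using dev that by (simp add: W_saa)
    show "0 \<le> \<delta> i \<omega> \<and> \<delta> i \<omega> \<le> 2 * M\<^sub>F" for i \<omega>
      using M_F_pos r0 Max_nonneg by (simp add: \<delta>_def)
    have restr: "indep_vars (\<lambda>i. PiM (J i) (\<lambda>_. \<Xi>M)) (\<lambda>i \<omega>. \<lambda>j\<in>J i. \<xi>s j \<omega>) {1..m}"
      using J_le J_disj by (intro indep_vars_restrict [OF indep]) auto
    \<comment> \<open>\<open>h i\<close> expresses \<open>\<delta> i\<close> as a measurable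
      function of the sample block \<open>J i\<close> alone, so that independence of the disjoint
      blocks passes to the \<delta>.\<close>
    define h where "h i w = min (2 * M\<^sub>F)
      (Max ((\<lambda>y. \<bar>(\<Sum>j\<in>J i. F y (w j)) / real n - f y\<bar>) ` S) + 2 * r)"
      for i and w :: "nat \<Rightarrow> real^'d"
    have "indep_vars (\<lambda>_. borel) (\<lambda>i \<omega>. h i (\<lambda>j\<in>J i. \<xi>s j \<omega>)) {1..m}"
    proof (rule indep_vars_compose2 [OF restr])
      fix i
      have "(\<lambda>w. F y (w j)) \<in> borel_measurable (PiM (J i) (\<lambda>_. \<Xi>M))" if "y \<in> S" "j \<in> J i" for y j
        using that S
        by (intro measurable_compose [OF measurable_component_singleton [OF that(2)]] F_measurable) auto
      then show "h i \<in> borel_measurable (PiM (J i) (\<lambda>_. \<Xi>M))"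
        unfolding h_def using S(1)
        by (intro borel_measurable_min borel_measurable_add borel_measurable_Max borel_measurable_abs
            borel_measurable_diff borel_measurable_divide borel_measurable_sum) auto
    qed
    also have "(\<lambda>i \<omega>. h i (\<lambda>j\<in>J i. \<xi>s j \<omega>)) = \<delta>"
      by (simp add: fun_eq_iff h_def \<delta>_def W_def)
    finally show "indep_vars (\<lambda>_. borel) \<delta> {1..m}" .
    fix i assume i: "i \<in> {1..m}"
    \<comment> \<open>The factor \<open>c\<close>, later \<open>1\<close> and \<open>- 1\<close>,
      treats both tails at once.\<close>
    have exp_le: "expectation (\<lambda>\<omega>. exp (l * ((\<Sum>j\<in>J i. c * F y (\<xi>s j \<omega>)) / card (J i) - c * f y))) \<le>
        exp (l\<^sup>2 * (M\<^sub>F\<^sup>2 / card (J i)) / 2)" if "y \<in> S" "l > 0" "\<bar>c\<bar> = 1" for y l c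
    proof (rule expectation_exp_mean_le [OF finJ neJ])
      have yX: "y \<in> X" using that S by auto
      show "indep_vars (\<lambda>_. borel) (\<lambda>j \<omega>. c * F y (\<xi>s j \<omega>)) (J i)"
        using F_measurable [OF yX] by (intro indep_vars_compose2 [OF indep_J [OF i]]) auto
      fix j assume "j \<in> J i"
      then have j: "j \<in> {1..m * n}" using J_le [OF i] by auto
      show "expectation (\<lambda>\<omega>. c * F y (\<xi>s j \<omega>)) = c * f y"
        using meanF [OF yX j] by simp
      show "\<bar>c * F y (\<xi>s j \<omega>)\<bar> \<le> M\<^sub>F" if "\<omega> \<in> space P" for \<omega>
        using F_abs_le [OF yX range [OF j that]] \<open>\<bar>c\<bar> = 1\<close> by (simp add: abs_mult)
    qed fact
    have Max_le: "expectation (\<lambda>\<omega>. Max ((\<lambda>y. \<bar>W y i \<omega>\<bar>) ` S)) \<le>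
        sqrt (2 * (M\<^sub>F\<^sup>2 / n) * ln (2 * real (card S)))"
    proof (rule expectation_Max_abs_le [OF S(1,2)])
      show "0 < M\<^sub>F\<^sup>2 / real n" using n M_F_pos by simp
      fix y assume y: "y \<in> S"
      then show "random_variable borel (W y i)" using rvW i S by auto
      show "\<bar>W y i \<omega>\<bar> \<le> 2 * M\<^sub>F" if "\<omega> \<in> space P" for \<omega>
        using W_bound i that y S by auto
      fix l :: real assume l: "l > 0"
      show "expectation (\<lambda>\<omega>. exp (l * W y i \<omega>)) \<le> exp (l\<^sup>2 * (M\<^sub>F\<^sup>2 / n) / 2)"
        using exp_le [OF y l, of 1] by (simp add: cardJ W_def)
      show "expectation (\<lambda>\<omega>. exp (- l * W y i \<omega>)) \<le> exp (l\<^sup>2 * (M\<^sub>F\<^sup>2 / n) / 2)"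
        using exp_le [OF y l, of "- 1"] by (simp add: cardJ W_def sum_negf algebra_simps)
    qed
    have rv_Max: "random_variable borel (\<lambda>\<omega>. Max ((\<lambda>y. \<bar>W y i \<omega>\<bar>) ` S))"
      using S rvW i by (intro borel_measurable_Max borel_measurable_abs) auto
    have Max_bound: "Max ((\<lambda>y. \<bar>W y i \<omega>\<bar>) ` S) \<le> 2 * M\<^sub>F" if "\<omega> \<in> space P" for \<omega>
      using S W_bound i that by (subst Max_le_iff) auto
    have int_Max: "integrable P (\<lambda>\<omega>. Max ((\<lambda>y. \<bar>W y i \<omega>\<bar>) ` S))"
      by (rule integrable_const_bound [OF AE_I2, where B = "2 * M\<^sub>F"])
        (use rv_Max Max_bound Max_nonneg in auto)
    have "expectation (\<delta> i) \<le> expectation (\<lambda>\<omega>. Max ((\<lambda>y. \<bar>W y i \<omega>\<bar>) ` S) + 2 * r)"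
    proof (rule integral_mono')
      show "integrable P (\<lambda>\<omega>. Max ((\<lambda>y. \<bar>W y i \<omega>\<bar>) ` S) + 2 * r)" using int_Max by simp
    qed (use Max_nonneg r0 in \<open>auto simp: \<delta>_def\<close>)
    also have "\<dots> = expectation (\<lambda>\<omega>. Max ((\<lambda>y. \<bar>W y i \<omega>\<bar>) ` S)) + 2 * r"
      using int_Max by (simp add: prob_space)
    also have "\<dots> \<le> sqrt (2 * (M\<^sub>F\<^sup>2 / n) * ln (2 * real (card S))) + 2 * r"
      using Max_le by simp
    also have "\<dots> \<le> 2 * N_const CARD('p) D L\<^sub>F \<gamma> M\<^sub>F lam / n powr lam"
      unfolding r_def using S
      by (intro grid_rate n gamma lam L D_nonneg M_F_pos k_def) (auto simp: Suc_le_eq card_gt_0_iff)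
    finally show "expectation (\<delta> i) \<le> 2 * N_const CARD('p) D L\<^sub>F \<gamma> M\<^sub>F lam / n powr lam" .
  qed
qed

subsection \<open>Moments of the pessimistic distance\<close>

text \<open>Either \<open>L\<^sub>F\<close> is nonnegative or both sides vanish. The bounds may thus
  be derived with \<open>max 0 L\<^sub>F\<close>, because the constant occurs there only multiplied
  by the diameter.\<close>

lemma diameter_N_const_eq:
  "diameter X * N_const p D (max 0 L\<^sub>F) \<gamma> M\<^sub>F lam = diameter X * N_const p D L\<^sub>F \<gamma> M\<^sub>F lam"
  using L_F_nonneg by (cases "diameter X = 0") (auto simp: max_def)

lemma diameter_N_const_nonneg:
  assumes "lam < 1 / 2"
  shows "0 \<le> diameter X * N_const p D L\<^sub>F \<gamma> M\<^sub>F lam"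
  unfolding diameter_N_const_eq [symmetric] using assms X_compact
  by (intro mult_nonneg_nonneg diameter_ge_0 N_const_nonneg compact_imp_bounded) auto

lemma compromise_dist_bound:
  assumes run: "algorithm_run P \<xi> \<Xi> X F m n \<xi>s fhat xhat \<upsilon> \<epsilon>\<^sub>1 \<epsilon>\<^sub>2"
    and m: "1 \<le> m" and eps: "0 < \<epsilon>" "\<epsilon> \<le> \<epsilon>\<^sub>1" and \<rho>: "0 < \<rho>" and \<omega>: "\<omega> \<in> space P"
    and dev: "\<And>i x. i \<in> {1..m} \<Longrightarrow> x \<in> X \<Longrightarrow>
      \<bar>saa F n (replication n (whole_sample (m * n) \<xi>s \<omega>) i) x - f x\<bar> \<le> \<delta> i"
  shows "0 \<le> compromise_dist P \<xi> X F m n \<xi>s fhat xhat \<upsilon> \<epsilon>\<^sub>2 \<rho> \<epsilon> \<omega>"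
    and "compromise_dist P \<xi> X F m n \<xi>s fhat xhat \<upsilon> \<epsilon>\<^sub>2 \<rho> \<epsilon> \<omega> \<le> (4 * ((\<Sum>i=1..m. \<delta> i) / m) + 2 * (\<epsilon>\<^sub>1 - \<epsilon>)) * diameter X / \<epsilon> + 2 * sqrt (\<epsilon> / \<rho>)"
proof -
  let ?d = "compromise_dist P \<xi> X F m n \<xi>s fhat xhat \<upsilon> \<epsilon>\<^sub>2 \<rho> \<epsilon> \<omega>"
  define s where "s = whole_sample (m * n) \<xi>s \<omega>"
  have oa: "outer_approximation X (saa F n (replication n s i)) (fhat (replication n s i))"
    and tc: "termination_condition X (saa F n (replication n s i)) (fhat (replication n s i))
      (xhat (replication n s i)) \<epsilon>\<^sub>1"
    and sg: "\<And>j. j \<in> {1..m} \<Longrightarrow>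
      eps_subgradient X (saa F n (replication n s i)) (xhat (replication n s j)) (\<upsilon> i j s) \<epsilon>\<^sub>2"
    if "i \<in> {1..m}" for i
    using run \<omega> that unfolding algorithm_run_def Let_def s_def by blast+
  have aug_le: "augmented_approx F m n fhat xhat \<upsilon> \<epsilon>\<^sub>2 s i x \<le> saa F n (replication n s i) x"
    if i: "i \<in> {1..m}" and x: "x \<in> X" for i x
    unfolding augmented_approx_def Let_def
  proof (rule max.boundedI)
    show "fhat (replication n s i) x \<le> saa F n (replication n s i) x"
      using oa [OF i] x by (auto simp: outer_approximation_def)
    show "Max ((\<lambda>j. saa F n (replication n s i) (xhat (replication n s j)) +
        \<upsilon> i j s \<bullet> (x - xhat (replication n s j)) - \<epsilon>\<^sub>2) ` {1..m}) \<le> saa F n (replication n s i) x"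
      using m sg [OF i] x by (intro Max.boundedI) (auto simp: eps_subgradient_def)
  qed
  note * = compromise_pess_dist [where f = f and X = X and m = m and \<epsilon> = \<epsilon> and \<epsilon>\<^sub>1 = \<epsilon>\<^sub>1
      and \<rho> = \<rho> and \<delta> = \<delta> and z = "\<lambda>i. xhat (replication n s i)"
      and g = "\<lambda>i. saa F n (replication n s i)" and h = "\<lambda>i. fhat (replication n s i)"
      and c = "augmented_approx F m n fhat xhat \<upsilon> \<epsilon>\<^sub>2 s"
      and G = "compromise_obj F m n fhat xhat \<upsilon> \<epsilon>\<^sub>2 \<rho> s",
      OF true_obj_convex compact_imp_bounded [OF X_compact] true_obj_bdd_below m eps \<rho>]
  have z: "xhat (replication n s i) \<in> X"
    and hmin: "\<And>x. x \<in> X \<Longrightarrow> fhat (replication n s i) (xhat (replication n s i)) \<le> fhat (replication n s i) x"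
    and gap: "saa F n (replication n s i) (xhat (replication n s i)) -
      fhat (replication n s i) (xhat (replication n s i)) \<le> \<epsilon>\<^sub>1"
    if "i \<in> {1..m}" for i
    using tc [OF that] by (auto simp: termination_condition_def is_arg_min_linorder)
  have aug_ge: "fhat (replication n s i) x \<le> augmented_approx F m n fhat xhat \<upsilon> \<epsilon>\<^sub>2 s i x" for i x
    by (simp add: augmented_approx_def)
  show "0 \<le> ?d"
    unfolding compromise_dist_def s_def [symmetric]
    by (rule *(1)) (auto intro: z hmin gap aug_ge aug_le dev [folded s_def] simp: compromise_obj_def)
  show "?d \<le> (4 * ((\<Sum>i=1..m. \<delta> i) / m) + 2 * (\<epsilon>\<^sub>1 - \<epsilon>)) * diameter X / \<epsilon> + 2 * sqrt (\<epsilon> / \<rho>)"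
    unfolding compromise_dist_def s_def [symmetric]
    by (rule *(2)) (auto intro: z hmin gap aug_ge aug_le dev [folded s_def] simp: compromise_obj_def)
qed

text \<open>Pointwise \<open>0 \<le> \<Delta> \<le> \<kappa> * a + c\<close>, where \<open>a\<close>
  is the average deviation. The mean follows at once, and the variance is bounded by the second
  moment, in which averaging over replications gives the term of order \<open>1 / m\<close>.\<close>

lemma compromise_dist_moments:
  fixes m n :: nat and lam \<epsilon> \<epsilon>\<^sub>1 \<epsilon>\<^sub>2 \<rho> :: real
  assumes run: "algorithm_run P \<xi> \<Xi> X F m n \<xi>s fhat xhat \<upsilon> \<epsilon>\<^sub>1 \<epsilon>\<^sub>2"
    and m: "1 \<le> m" and n: "1 \<le> n" and eps: "0 < \<epsilon>" "\<epsilon> \<le> \<epsilon>\<^sub>1" and \<rho>: "0 < \<rho>" and lam: "lam < 1 / 2"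
    and meas: "compromise_dist P \<xi> X F m n \<xi>s fhat xhat \<upsilon> \<epsilon>\<^sub>2 \<rho> \<epsilon> \<in> borel_measurable P"
  defines "N \<equiv> N_const CARD('p) D L\<^sub>F \<gamma> M\<^sub>F lam"
    and "\<Delta> \<equiv> compromise_dist P \<xi> X F m n \<xi>s fhat xhat \<upsilon> \<epsilon>\<^sub>2 \<rho> \<epsilon>"
  defines "b \<equiv> 8 * diameter X * N / (\<epsilon> * n powr lam) + 2 * (\<epsilon>\<^sub>1 - \<epsilon>) * diameter X / \<epsilon> + 2 * sqrt (\<epsilon> / \<rho>)"
  shows "0 \<le> b" and "expectation \<Delta> \<le> b"
    and "variance \<Delta> \<le> 64 * (diameter X)\<^sup>2 * M\<^sub>F * N / (m * \<epsilon>\<^sup>2 * n powr lam) + b\<^sup>2"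
proof -
  \<comment> \<open>The Hoelder condition also holds with \<open>max 0 L\<^sub>F\<close>, which
    provides the sign that \<open>uniform_deviation\<close> requires; \<open>DN\<close> returns to
    the original constant.\<close>
  interpret nonneg: stochastic_program P \<xi> \<Xi> X F D "max 0 L\<^sub>F" \<gamma> M\<^sub>F
  proof unfold_locales
    show "\<bar>F x y - F x' y\<bar> \<le> max 0 L\<^sub>F * norm (x - x') powr \<gamma>"
      if "x \<in> X" "x' \<in> X" "y \<in> \<Xi>" for x x' y
      using F_hoelder [OF that] by (rule order_trans) (intro mult_right_mono, auto)
  qed (use xi_measurable xi_range X_nonempty X_compact X_convex X_cube F_continuous F_measurable
      gamma M_F_pos F_bounded F_convex in auto)
  have iid: "iid_copies P \<xi> \<Xi> (m * n) \<xi>s" using run by (simp add: algorithm_run_def)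
  define N' where "N' = N_const CARD('p) D (max 0 L\<^sub>F) \<gamma> M\<^sub>F lam"
  define \<kappa> where "\<kappa> = 4 * diameter X / \<epsilon>"
  define e where "e = 2 * N' / n powr lam"
  define c where "c = 2 * (\<epsilon>\<^sub>1 - \<epsilon>) * diameter X / \<epsilon> + 2 * sqrt (\<epsilon> / \<rho>)"
  have D0: "0 \<le> diameter X" by (intro diameter_ge_0 compact_imp_bounded X_compact)
  have \<kappa>0: "0 \<le> \<kappa>" and c0: "0 \<le> c"
    using D0 eps \<rho> by (simp_all add: \<kappa>_def c_def)
  have DN: "diameter X * N' = diameter X * N"
    unfolding N'_def N_def by (rule diameter_N_const_eq)
  have \<kappa>e: "\<kappa> * e = 8 * (diameter X * N) / (\<epsilon> * n powr lam)"
    unfolding DN [symmetric] by (simp add: \<kappa>_def e_def)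
  have b: "b = \<kappa> * e + c" unfolding \<kappa>e by (simp add: b_def c_def)
  have N'0: "0 \<le> N'" unfolding N'_def using lam by (intro N_const_nonneg) auto
  then have e0: "0 \<le> e" by (simp add: e_def)
  show b0: "0 \<le> b" unfolding b using \<kappa>0 e0 c0 by simp
  obtain \<delta> where indep: "indep_vars (\<lambda>_. borel) \<delta> {1..m}"
    and range: "\<And>i \<omega>. i \<in> {1..m} \<Longrightarrow> \<omega> \<in> space P \<Longrightarrow> 0 \<le> \<delta> i \<omega> \<and> \<delta> i \<omega> \<le> 2 * M\<^sub>F"
    and mean: "\<And>i. i \<in> {1..m} \<Longrightarrow> expectation (\<delta> i) \<le> e"
    and dev: "\<And>i \<omega> x. i \<in> {1..m} \<Longrightarrow> \<omega> \<in> space P \<Longrightarrow> x \<in> X \<Longrightarrow>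
      \<bar>saa F n (replication n (whole_sample (m * n) \<xi>s \<omega>) i) x - f x\<bar> \<le> \<delta> i \<omega>"
    using nonneg.uniform_deviation [OF iid n _ lam] unfolding e_def N'_def by auto
  define a where "a \<omega> = (\<Sum>i=1..m. \<delta> i \<omega>) / real m" for \<omega>
  have \<Delta>: "0 \<le> \<Delta> \<omega>" "\<Delta> \<omega> \<le> \<kappa> * a \<omega> + c" if "\<omega> \<in> space P" for \<omega>
  proof -
    note * = compromise_dist_bound [OF run m eps \<rho> that dev [OF _ that]]
    show "0 \<le> \<Delta> \<omega>" using *(1) by (simp add: \<Delta>_def)
    have "(4 * ((\<Sum>i=1..m. \<delta> i \<omega>) / m) + 2 * (\<epsilon>\<^sub>1 - \<epsilon>)) * diameter X / \<epsilon> + 2 * sqrt (\<epsilon> / \<rho>) =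
        \<kappa> * a \<omega> + c"
      unfolding a_def [symmetric] \<kappa>_def c_def using eps by (simp add: field_simps)
    with *(2) show "\<Delta> \<omega> \<le> \<kappa> * a \<omega> + c" by (simp add: \<Delta>_def)
  qed
  have rv: "random_variable borel (\<delta> i)" if "i \<in> {1..m}" for i
    using indep that by (auto simp: indep_vars_def)
  have int\<delta>: "integrable P (\<delta> i)" if "i \<in> {1..m}" for i
    by (rule integrable_const_bound [OF AE_I2, where B = "2 * M\<^sub>F"]) (use range that rv in auto)
  have int_a: "integrable P a"
    unfolding a_def using int\<delta> by (intro integrable_divide Bochner_Integration.integrable_sum) auto
  have a_range: "0 \<le> a \<omega>" "a \<omega> \<le> 2 * M\<^sub>F" if "\<omega> \<in> space P" for \<omega>
  proof -
    show "0 \<le> a \<omega>"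
      unfolding a_def using range that by (intro divide_nonneg_nonneg sum_nonneg) auto
    have "(\<Sum>i=1..m. \<delta> i \<omega>) \<le> (\<Sum>i=1..m. 2 * M\<^sub>F)"
      using range that by (intro sum_mono) auto
    then show "a \<omega> \<le> 2 * M\<^sub>F" using m by (simp add: a_def field_simps)
  qed
  have int_a2: "integrable P (\<lambda>\<omega>. (a \<omega>)\<^sup>2)"
  proof (rule integrable_const_bound [OF AE_I2, where B = "(2 * M\<^sub>F)\<^sup>2"])
    show "norm ((a \<omega>)\<^sup>2) \<le> (2 * M\<^sub>F)\<^sup>2" if "\<omega> \<in> space P" for \<omega>
      using a_range [OF that] unfolding norm_power by (intro power_mono) auto
  qed (use int_a in \<open>auto intro!: borel_measurable_power\<close>)
  have Ea: "expectation a \<le> e"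
  proof -
    have "expectation a = (\<Sum>i=1..m. expectation (\<delta> i)) / m"
      unfolding a_def using int\<delta> by simp
    also have "\<dots> \<le> (\<Sum>i=1..m. e) / m" using mean by (intro divide_right_mono sum_mono) auto
    also have "\<dots> = e" using m by simp
    finally show ?thesis .
  qed
  have Ea2: "expectation (\<lambda>\<omega>. (a \<omega>)\<^sup>2) \<le> 2 * M\<^sub>F * e / m + e\<^sup>2"
    using expectation_square_mean_le [OF _ _ indep range mean] m by (simp add: a_def)
  have bound: "norm (\<Delta> \<omega>) \<le> \<kappa> * (2 * M\<^sub>F) + c" if "\<omega> \<in> space P" for \<omega>
  proof -
    have "\<kappa> * a \<omega> \<le> \<kappa> * (2 * M\<^sub>F)" using a_range [OF that] \<kappa>0 by (intro mult_left_mono) auto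
    with \<Delta> [OF that] show ?thesis by simp
  qed
  have meas': "\<Delta> \<in> borel_measurable P" using meas by (simp add: \<Delta>_def)
  have int\<Delta>: "integrable P \<Delta>"
    by (rule integrable_const_bound [OF AE_I2 meas']) (rule bound)
  have int\<Delta>2: "integrable P (\<lambda>\<omega>. (\<Delta> \<omega>)\<^sup>2)"
  proof (rule integrable_const_bound [OF AE_I2, where B = "(\<kappa> * (2 * M\<^sub>F) + c)\<^sup>2"])
    show "norm ((\<Delta> \<omega>)\<^sup>2) \<le> (\<kappa> * (2 * M\<^sub>F) + c)\<^sup>2" if "\<omega> \<in> space P" for \<omega>
      using bound [OF that] \<Delta>(1) [OF that] unfolding norm_power by (intro power_mono) auto
  qed (use meas' in measurable)
  have "expectation \<Delta> \<le> expectation (\<lambda>\<omega>. \<kappa> * a \<omega> + c)"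
    using \<Delta> int\<Delta> int_a by (intro integral_mono) auto
  also have "\<dots> = \<kappa> * expectation a + c" using int_a by (simp add: prob_space)
  also have "\<dots> \<le> b" unfolding b using Ea \<kappa>0 by (simp add: mult_left_mono)
  finally show "expectation \<Delta> \<le> b" .
  have "variance \<Delta> \<le> expectation (\<lambda>\<omega>. (\<Delta> \<omega>)\<^sup>2)"
    by (simp add: variance_eq [OF int\<Delta> int\<Delta>2])
  also have "\<dots> \<le> expectation (\<lambda>\<omega>. \<kappa>\<^sup>2 * (a \<omega>)\<^sup>2 + 2 * \<kappa> * c * a \<omega> + c\<^sup>2)"
  proof (rule integral_mono [OF int\<Delta>2])
    fix \<omega> assume \<omega>: "\<omega> \<in> space P"
    have "(\<Delta> \<omega>)\<^sup>2 \<le> (\<kappa> * a \<omega> + c)\<^sup>2" using \<Delta> [OF \<omega>] by (intro power_mono) auto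
    also have "\<dots> = \<kappa>\<^sup>2 * (a \<omega>)\<^sup>2 + 2 * \<kappa> * c * a \<omega> + c\<^sup>2"
      by (simp add: power2_sum power_mult_distrib)
    finally show "(\<Delta> \<omega>)\<^sup>2 \<le> \<dots>" .
  qed (use int_a int_a2 in auto)
  also have "\<dots> = \<kappa>\<^sup>2 * expectation (\<lambda>\<omega>. (a \<omega>)\<^sup>2) + 2 * \<kappa> * c * expectation a + c\<^sup>2"
    using int_a int_a2 by (simp add: prob_space)
  also have "\<dots> \<le> \<kappa>\<^sup>2 * (2 * M\<^sub>F * e / m + e\<^sup>2) + 2 * \<kappa> * c * e + c\<^sup>2"
    using Ea Ea2 \<kappa>0 c0 by (intro add_mono mult_left_mono) auto
  \<comment> \<open>The terms without \<open>1 / m\<close> complete the square of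
    \<open>b = \<kappa> * e + c\<close>.\<close>
  also have "\<dots> = \<kappa> * (\<kappa> * e) * (2 * M\<^sub>F) / m + b\<^sup>2"
    by (simp add: b power2_sum power_mult_distrib power2_eq_square algebra_simps)
  also have "\<kappa> * (\<kappa> * e) * (2 * M\<^sub>F) / m = 64 * (diameter X)\<^sup>2 * M\<^sub>F * N / (m * \<epsilon>\<^sup>2 * n powr lam)"
    unfolding \<kappa>e by (simp add: \<kappa>_def power2_eq_square mult_ac)
  finally show "variance \<Delta> \<le> 64 * (diameter X)\<^sup>2 * M\<^sub>F * N / (m * \<epsilon>\<^sup>2 * n powr lam) + b\<^sup>2" .
qed

end

section \<open>From the moment bounds to the explicit variance bound and the rates\<close>

theorem theorem4p4:
  fixes P :: "'w measure"
    and \<xi> :: "'w \<Rightarrow> real^'d"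
    and \<Xi> :: "(real^'d) set"
    and X :: "(real^'p) set"
    and F :: "real^'p \<Rightarrow> real^'d \<Rightarrow> real"
    and D L\<^sub>F \<gamma> M\<^sub>F lam \<epsilon> :: real
  defines "N\<^sub>F \<equiv> N_const CARD('p) D L\<^sub>F \<gamma> M\<^sub>F lam"
    and "D\<^sub>X \<equiv> diameter X"
  assumes "stochastic_program P \<xi> \<Xi> X F D L\<^sub>F \<gamma> M\<^sub>F"
    and "0 < lam" and "lam < 1 / 2"
    and "0 < \<epsilon>"
  shows
    "(\<forall>m n \<xi>s fhat xhat \<upsilon> \<epsilon>\<^sub>1 \<epsilon>\<^sub>2 \<rho>.
        1 \<le> m \<longrightarrow> 1 \<le> n \<longrightarrow> 0 < \<epsilon>\<^sub>1 \<longrightarrow> 0 \<le> \<epsilon>\<^sub>2 \<longrightarrow> 0 < \<rho> \<longrightarrow> \<epsilon> \<le> \<epsilon>\<^sub>1 \<longrightarrow>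
        algorithm_run P \<xi> \<Xi> X F m n \<xi>s fhat xhat \<upsilon> \<epsilon>\<^sub>1 \<epsilon>\<^sub>2 \<longrightarrow>
        compromise_dist P \<xi> X F m n \<xi>s fhat xhat \<upsilon> \<epsilon>\<^sub>2 \<rho> \<epsilon> \<in> borel_measurable P \<longrightarrow>
        (let \<tau>\<^sub>1 = \<epsilon>\<^sub>1 - \<epsilon>; \<tau>\<^sub>2 = \<epsilon>\<^sub>1 + (real m - 1) / real m * \<epsilon>\<^sub>2 - \<epsilon> in
          prob_space.variance P (compromise_dist P \<xi> X F m n \<xi>s fhat xhat \<upsilon> \<epsilon>\<^sub>2 \<rho> \<epsilon>)
            \<le> 64 * D\<^sub>X\<^sup>2 * M\<^sub>F * N\<^sub>F / (real m * \<epsilon>\<^sup>2 * real n powr lam) +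
              (8 * D\<^sub>X * N\<^sub>F / (\<epsilon> * real n powr lam) + (\<tau>\<^sub>1 + \<tau>\<^sub>2) * D\<^sub>X / \<epsilon> +
               2 * sqrt (\<epsilon> / \<rho>))\<^sup>2)) \<and>
     (\<forall>K\<^sub>1 > 0. \<exists>C C'. \<forall>m n \<xi>s fhat xhat \<upsilon> \<rho>.
        1 \<le> m \<longrightarrow> 1 \<le> n \<longrightarrow> K\<^sub>1 * real n \<le> \<rho> \<longrightarrow>
        algorithm_run P \<xi> \<Xi> X F m n \<xi>s fhat xhat \<upsilon> \<epsilon> 0 \<longrightarrow>
        compromise_dist P \<xi> X F m n \<xi>s fhat xhat \<upsilon> 0 \<rho> \<epsilon> \<in> borel_measurable P \<longrightarrow>
        prob_space.expectation P (compromise_dist P \<xi> X F m n \<xi>s fhat xhat \<upsilon> 0 \<rho> \<epsilon>)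
          \<le> C * (1 / real n powr lam) \<and>
        prob_space.variance P (compromise_dist P \<xi> X F m n \<xi>s fhat xhat \<upsilon> 0 \<rho> \<epsilon>)
          \<le> C' * (1 / (real m * real n powr lam) + 1 / real n powr (2 * lam)))"
proof -
  interpret stochastic_program P \<xi> \<Xi> X F D L\<^sub>F \<gamma> M\<^sub>F by fact
  have D0: "0 \<le> D\<^sub>X" unfolding D\<^sub>X_def by (intro diameter_ge_0 compact_imp_bounded X_compact)
  \<comment> \<open>Only the product has a guaranteed sign, since \<open>N\<^sub>F\<close> may be
    negative when \<open>X\<close> is a singleton. The constants below therefore keep the two
    factors together.\<close>
  have DN: "0 \<le> D\<^sub>X * N\<^sub>F" unfolding D\<^sub>X_def N\<^sub>F_def by (intro diameter_N_const_nonneg) fact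
  note moments = compromise_dist_moments [where lam = lam, folded N\<^sub>F_def D\<^sub>X_def]
  show ?thesis
  proof (intro conjI allI impI)
    fix m n \<xi>s fhat xhat \<upsilon> and \<epsilon>\<^sub>1 \<epsilon>\<^sub>2 \<rho> :: real
    assume m: "1 \<le> m" and n: "1 \<le> n" and e2: "0 \<le> \<epsilon>\<^sub>2" and \<rho>: "0 < \<rho>" and e1: "\<epsilon> \<le> \<epsilon>\<^sub>1"
      and run: "algorithm_run P \<xi> \<Xi> X F m n \<xi>s fhat xhat \<upsilon> \<epsilon>\<^sub>1 \<epsilon>\<^sub>2"
      and meas: "compromise_dist P \<xi> X F m n \<xi>s fhat xhat \<upsilon> \<epsilon>\<^sub>2 \<rho> \<epsilon> \<in> borel_measurable P"
    note mom = moments [OF run m n \<open>0 < \<epsilon>\<close> e1 \<rho> \<open>lam < 1 / 2\<close> meas]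
    define \<tau> where "\<tau> = (\<epsilon>\<^sub>1 - \<epsilon>) + (\<epsilon>\<^sub>1 + (real m - 1) / real m * \<epsilon>\<^sub>2 - \<epsilon>)"
    \<comment> \<open>This is the amount by which \<open>\<tau>\<^sub>1 + \<tau>\<^sub>2\<close>
      exceeds the \<open>2 * (\<epsilon>\<^sub>1 - \<epsilon>)\<close> of the moment bound.\<close>
    have "0 \<le> (real m - 1) / real m * \<epsilon>\<^sub>2" using m e2 by simp
    then have "2 * (\<epsilon>\<^sub>1 - \<epsilon>) \<le> \<tau>" by (simp add: \<tau>_def)
    then have "2 * (\<epsilon>\<^sub>1 - \<epsilon>) * D\<^sub>X / \<epsilon> \<le> \<tau> * D\<^sub>X / \<epsilon>"
      using D0 \<open>0 < \<epsilon>\<close> by (intro divide_right_mono mult_right_mono) auto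
    then have "(8 * D\<^sub>X * N\<^sub>F / (\<epsilon> * n powr lam) + 2 * (\<epsilon>\<^sub>1 - \<epsilon>) * D\<^sub>X / \<epsilon> + 2 * sqrt (\<epsilon> / \<rho>))\<^sup>2 \<le>
        (8 * D\<^sub>X * N\<^sub>F / (\<epsilon> * n powr lam) + \<tau> * D\<^sub>X / \<epsilon> + 2 * sqrt (\<epsilon> / \<rho>))\<^sup>2"
      using mom(1) by (intro power_mono) auto
    with mom(3) show "let \<tau>\<^sub>1 = \<epsilon>\<^sub>1 - \<epsilon>; \<tau>\<^sub>2 = \<epsilon>\<^sub>1 + (real m - 1) / real m * \<epsilon>\<^sub>2 - \<epsilon> in
          prob_space.variance P (compromise_dist P \<xi> X F m n \<xi>s fhat xhat \<upsilon> \<epsilon>\<^sub>2 \<rho> \<epsilon>)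
            \<le> 64 * D\<^sub>X\<^sup>2 * M\<^sub>F * N\<^sub>F / (real m * \<epsilon>\<^sup>2 * real n powr lam) +
              (8 * D\<^sub>X * N\<^sub>F / (\<epsilon> * real n powr lam) + (\<tau>\<^sub>1 + \<tau>\<^sub>2) * D\<^sub>X / \<epsilon> +
               2 * sqrt (\<epsilon> / \<rho>))\<^sup>2"
      unfolding Let_def \<tau>_def by linarith
  next
    fix K\<^sub>1 :: real assume K: "0 < K\<^sub>1"
    \<comment> \<open>For \<open>\<epsilon>\<^sub>1 = \<epsilon>\<close> the middle term of the
      bound is zero. The proximal term is at most
      \<open>2 * sqrt (\<epsilon> / K\<^sub>1) / sqrt n\<close> because
      \<open>\<rho> \<ge> K\<^sub>1 * n\<close>, and \<open>lam < 1 / 2\<close> brings it to the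
      common rate.\<close>
    define C where "C = 8 * (D\<^sub>X * N\<^sub>F) / \<epsilon> + 2 * sqrt (\<epsilon> / K\<^sub>1)"
    define C\<^sub>2 where "C\<^sub>2 = 64 * D\<^sub>X * M\<^sub>F * (D\<^sub>X * N\<^sub>F) / \<epsilon>\<^sup>2"
    have C2: "0 \<le> C\<^sub>2" using D0 DN M_F_pos by (simp add: C\<^sub>2_def)
    show "\<exists>C C'. \<forall>m n \<xi>s fhat xhat \<upsilon> \<rho>.
        1 \<le> m \<longrightarrow> 1 \<le> n \<longrightarrow> K\<^sub>1 * real n \<le> \<rho> \<longrightarrow>
        algorithm_run P \<xi> \<Xi> X F m n \<xi>s fhat xhat \<upsilon> \<epsilon> 0 \<longrightarrow>
        compromise_dist P \<xi> X F m n \<xi>s fhat xhat \<upsilon> 0 \<rho> \<epsilon> \<in> borel_measurable P \<longrightarrow>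
        expectation (compromise_dist P \<xi> X F m n \<xi>s fhat xhat \<upsilon> 0 \<rho> \<epsilon>)
          \<le> C * (1 / real n powr lam) \<and>
        variance (compromise_dist P \<xi> X F m n \<xi>s fhat xhat \<upsilon> 0 \<rho> \<epsilon>)
          \<le> C' * (1 / (real m * real n powr lam) + 1 / real n powr (2 * lam))"
    proof (rule exI [of _ C], rule exI [of _ "C\<^sub>2 + C\<^sup>2"], intro allI impI)
      fix m n \<xi>s fhat xhat \<upsilon> \<rho>
      assume m: "1 \<le> m" and n: "1 \<le> n" and K\<rho>: "K\<^sub>1 * real n \<le> \<rho>"
        and run: "algorithm_run P \<xi> \<Xi> X F m n \<xi>s fhat xhat \<upsilon> \<epsilon> 0"
        and meas: "compromise_dist P \<xi> X F m n \<xi>s fhat xhat \<upsilon> 0 \<rho> \<epsilon> \<in> borel_measurable P"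
      have Kn: "0 < K\<^sub>1 * real n" using K n by simp
      with K\<rho> have \<rho>: "0 < \<rho>" by linarith
      note mom = moments [OF run m n \<open>0 < \<epsilon>\<close> order_refl \<rho> \<open>lam < 1 / 2\<close> meas, simplified]
      have "sqrt (\<epsilon> / \<rho>) \<le> sqrt (\<epsilon> / (K\<^sub>1 * n))"
        using K\<rho> Kn \<rho> \<open>0 < \<epsilon>\<close> by (intro real_sqrt_le_mono divide_left_mono) auto
      also have "\<dots> = sqrt (\<epsilon> / K\<^sub>1) * (1 / n powr (1 / 2))"
        by (simp add: real_sqrt_mult real_sqrt_divide powr_half_sqrt)
      also have "\<dots> \<le> sqrt (\<epsilon> / K\<^sub>1) * (1 / n powr lam)"
        using n K \<open>0 < \<epsilon>\<close> \<open>lam < 1 / 2\<close>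
        by (intro mult_left_mono divide_left_mono powr_mono) auto
      finally have le: "8 * D\<^sub>X * N\<^sub>F / (\<epsilon> * n powr lam) + 2 * sqrt (\<epsilon> / \<rho>) \<le> C * (1 / n powr lam)"
        by (simp add: C_def distrib_right add_divide_distrib)
      show "expectation (compromise_dist P \<xi> X F m n \<xi>s fhat xhat \<upsilon> 0 \<rho> \<epsilon>)
          \<le> C * (1 / real n powr lam) \<and>
        variance (compromise_dist P \<xi> X F m n \<xi>s fhat xhat \<upsilon> 0 \<rho> \<epsilon>)
          \<le> (C\<^sub>2 + C\<^sup>2) * (1 / (real m * real n powr lam) + 1 / real n powr (2 * lam))"
      proof
        show "expectation (compromise_dist P \<xi> X F m n \<xi>s fhat xhat \<upsilon> 0 \<rho> \<epsilon>)
          \<le> C * (1 / real n powr lam)"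
          using mom(2) le by linarith
        have "(8 * D\<^sub>X * N\<^sub>F / (\<epsilon> * n powr lam) + 2 * sqrt (\<epsilon> / \<rho>))\<^sup>2 \<le> (C * (1 / n powr lam))\<^sup>2"
          using mom(1) le by (intro power_mono)
        also have "\<dots> = C\<^sup>2 * (1 / n powr (2 * lam))"
          using n by (simp add: power_mult_distrib power_divide powr_power mult.commute)
        finally have sq: "(8 * D\<^sub>X * N\<^sub>F / (\<epsilon> * n powr lam) + 2 * sqrt (\<epsilon> / \<rho>))\<^sup>2 \<le>
          C\<^sup>2 * (1 / n powr (2 * lam))" .
        have "64 * D\<^sub>X\<^sup>2 * M\<^sub>F * N\<^sub>F / (m * \<epsilon>\<^sup>2 * n powr lam) = C\<^sub>2 * (1 / (real m * real n powr lam))"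
          by (simp add: C\<^sub>2_def power2_eq_square mult_ac)
        with mom(3) sq have "variance (compromise_dist P \<xi> X F m n \<xi>s fhat xhat \<upsilon> 0 \<rho> \<epsilon>) \<le>
            C\<^sub>2 * (1 / (real m * real n powr lam)) + C\<^sup>2 * (1 / n powr (2 * lam))"
          by linarith
        also have "\<dots> \<le> (C\<^sub>2 + C\<^sup>2) * (1 / (real m * real n powr lam)) +
            (C\<^sub>2 + C\<^sup>2) * (1 / n powr (2 * lam))"
          using C2 by (intro add_mono mult_right_mono) auto
        finally show "variance (compromise_dist P \<xi> X F m n \<xi>s fhat xhat \<upsilon> 0 \<rho> \<epsilon>)
          \<le> (C\<^sub>2 + C\<^sup>2) * (1 / (real m * real n powr lam) + 1 / real n powr (2 * lam))"
          by (simp add: distrib_left)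
      qed
    qed
  qed
qed

end
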